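(* Let $A=[a_{ij}]_{i,j\in I}$ be a symmetrizable generalized Cartan matrix symmetrized by $\{d_i\}_{i\in I}$ with a root datum $(Y,X,\langle\,,\rangle,\{\alpha_i^\vee\},\{\alpha_i\})$ of type $A$, let $\mathcal A_{q,0}$ be a quotient algebra of $U_q^-$ which is a tempered domain, let $f_i$ be the image of the Chevalley generator $F_i$ in $\mathcal A_{q,0}$, and let $\mathcal A_q=\mathcal A_{q,0}\otimes U_q^0$. Fix $i\in I$ with $f_i\ne0$. Then for every $n\in\mathbb Z$ and $j\ne i$, in the skew field of fractions of $\mathcal A_{q,0}$, $$f_i^nf_jf_i^{-n}=\sum_{k=0}^{-a_{ij}}q_i^{(k+a_{ij})(n-k)}\begin{bmatrix}n\\k\end{bmatrix}_{q_i}\mathrm{ad}(f_i)^k(f_j)f_i^{-k},$$ and, for every $\lambda\in Y$, there is a well-defined (unique) algebra automorphism $\gamma(f_i^\lambda)$ of the skew field of fractions $Q(\mathcal A_q)$ such that $\gamma(f_i^\lambda)(q^\mu)=q^\mu$ for $\mu\in d^{-1}Y$ and $$\gamma(f_i^\lambda)(f_j)=\begin{cases}\displaystyle\sum_{k=0}^{-a_{ij}}q_i^{(k+a_{ij})(\lambda-k)}\begin{bmatrix}\lambda\\k\end{bmatrix}_{q_i}\mathrm{ad}(f_i)^k(f_j)f_i^{-k}&\text{if }i\ne j,\\ f_i&\text{if }i=j.\end{cases}$$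
   Context: Generalized Cartan matrix: a matrix $A=[a_{ij}]_{i,j\in I}$ ($I$ finite) of integers with $a_{ii}=2$, $a_{ij}\le 0$ for $i\ne j$, and $a_{ij}=0\iff a_{ji}=0$. It is symmetrized by positive rationals $\{d_i\}$ if $d_ia_{ij}=d_ja_{ji}$ for all $i,j$. A root datum of type $A$: finitely generated free $\mathbb Z$-modules $X,Y$, a perfect bilinear pairing $\langle\,,\rangle:Y\times X\to\mathbb Z$, and families $\alpha_i^\vee\in Y$, $\alpha_i\in X$ with $\langle\alpha_i^\vee,\alpha_j\rangle=a_{ij}$. Let $d$ be the least common denominator of the $d_i$, $\mathbb F=\mathbb Q(q^{1/d})$ ($q^{1/d}$ an indeterminate), $q_i=q^{d_i}$. $q$-numbers: $[x]_q=\frac{q^x-q^{-x}}{q-q^{-1}}$, $[n]_q!=\prod_{k=1}^n[k]_q$, $\begin{bmatrix}x\\k\end{bmatrix}_q=\frac{[x]_q[x-1]_q\cdots[x-k+1]_q}{[k]_q!}$. $U_q^-$ is the $\mathbb F$-algebra generated by $\{F_i\}_{i\in I}$ with the $q$-Serre relations $\sum_{k=0}^{1-a_{ij}}(-1)^k\begin{bmatrix}1-a_{ij}\\k\end{bmatrix}_{q_i}F_i^kF_jF_i^{1-a_{ij}-k}=0$ ($i\ne j$). $U_q^0=\bigoplus_{\lambda\in d^{-1}Y}\mathbb Fq^\lambda$ is the group algebra of $d^{-1}Y$. In $\mathcal A_q=\mathcal A_{q,0}\otimes_{\mathbb F}U_q^0$ the $q^\lambda$ commute with the $f_j$. A filtration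 of an $\mathbb F$-algebra $B$ is an increasing sequence of subspaces $F_0B\subset F_1B\subset\cdots$ with union $B$, $1\in F_0B$, $F_kB\,F_lB\subset F_{k+l}B$; $B$ is a tempered domain if it is an integral domain (possibly non-commutative) having a filtration with all $\dim_{\mathbb F}F_kB<\infty$ and $\limsup_k(\dim_{\mathbb F}F_kB)^{1/k}\le1$. A tempered domain is an Ore domain; $\mathcal A_{q,0}$ and $\mathcal A_q$ are both tempered domains, so they have skew fields of fractions. $\mathrm{ad}(f_i)^k(f_j)=\sum_{\nu=0}^k(-1)^\nu q_i^{\nu(k-1+a_{ij})}\begin{bmatrix}k\\\nu\end{bmatrix}_{q_i}f_i^{k-\nu}f_jf_i^\nu$. For $\lambda\in Y$: $q_i^{\lambda}=q^{d_i\lambda}\in U_q^0$, $q_i^{m(\lambda-k)}=(q_i^\lambda)^mq_i^{-mk}$, and $\begin{bmatrix}\lambda\\k\end{bmatrix}_{q_i}=\frac{[\lambda]_{q_i}[\lambda-1]_{q_i}\cdots[\lambda-k+1]_{q_i}}{[k]_{q_i}!}$ with $[\lambda-\nu]_{q_i}=\frac{q_i^\lambda q_i^{-\nu}-q_i^{-\lambda}q_i^{\nu}}{q_i-q_i^{-1}}\in U_q^0$. *)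

theory Defs
  imports
    Complex_Main
    "HOL-Library.Poly_Mapping"
    "HOL-Library.Extended_Real"
    "HOL-Library.Liminf_Limsup"
    "HOL-Computational_Algebra.Polynomial"
    "HOL-Computational_Algebra.Fraction_Field"
begin

section \<open>The ground field\<close>

text \<open>
  The field of rational functions over the rationals in one indeterminate. The indeterminate
  stands for \<open>q^(1/d)\<close>; the number \<open>d\<close> enters only through the exponents used below.
\<close>

type_synonym qfield = "rat poly fract"

definition qroot :: qfield where
  "qroot = Fract [:0, 1:] 1"

definition common_denom :: "('i \<Rightarrow> rat) \<Rightarrow> nat" where
  "common_denom ds = (LEAST n. 0 < n \<and> (\<forall>i. of_nat n * ds i \<in> \<int>))"

text \<open>The integer \<open>d * d\<^sub>i\<close>; the floor is only there to change the type.\<close>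

definition dnum :: "('i \<Rightarrow> rat) \<Rightarrow> 'i \<Rightarrow> int" where
  "dnum ds i = \<lfloor>of_nat (common_denom ds) * ds i\<rfloor>"

text \<open>\<open>q\<^sub>i = q^(d\<^sub>i) = (q^(1/d))^(d * d\<^sub>i)\<close>\<close>

definition qi :: "('i \<Rightarrow> rat) \<Rightarrow> 'i \<Rightarrow> qfield" where
  "qi ds i = qroot powi dnum ds i"

definition qint :: "'k::field \<Rightarrow> int \<Rightarrow> 'k" where
  "qint v x = (v powi x - v powi (- x)) / (v - inverse v)"

definition qfact :: "'k::field \<Rightarrow> nat \<Rightarrow> 'k" where
  "qfact v n = (\<Prod>k=1..n. qint v (int k))"

definition qbinom :: "'k::field \<Rightarrow> int \<Rightarrow> nat \<Rightarrow> 'k" where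
  "qbinom v x k = (\<Prod>\<nu><k. qint v (x - int \<nu>)) / qfact v k"


section \<open>Cartan matrices and root data\<close>

definition gen_cartan_matrix :: "('i \<Rightarrow> 'i \<Rightarrow> int) \<Rightarrow> bool" where
  "gen_cartan_matrix A \<longleftrightarrow>
     (\<forall>i. A i i = 2) \<and>
     (\<forall>i j. i \<noteq> j \<longrightarrow> A i j \<le> 0) \<and>
     (\<forall>i j. A i j = 0 \<longleftrightarrow> A j i = 0)"

definition symmetrized_by :: "('i \<Rightarrow> 'i \<Rightarrow> int) \<Rightarrow> ('i \<Rightarrow> rat) \<Rightarrow> bool" where
  "symmetrized_by A ds \<longleftrightarrow>
     (\<forall>i. 0 < ds i) \<and> (\<forall>i j. ds i * of_int (A i j) = ds j * of_int (A j i))"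

definition zscale :: "int \<Rightarrow> 'y::ab_group_add \<Rightarrow> 'y" where
  "zscale n y = (if 0 \<le> n then ((+) y ^^ nat n) 0 else - (((+) y ^^ nat (- n)) 0))"

lemma zscale_0 [simp]: "zscale 0 y = 0"
  by (simp add: zscale_def)

lemma zscale_1 [simp]: "zscale 1 y = y"
  by (simp add: zscale_def)

lemma zscale_succ: "zscale (n + 1) y = zscale n y + y"
proof (cases "0 \<le> n")
  case True
  then have "nat (n + 1) = Suc (nat n)" by simp
  with True show ?thesis by (simp add: zscale_def add.commute)
next
  case False
  then have "nat (- n) = Suc (nat (- (n + 1)))" by simp
  with False show ?thesis
    by (cases "n = -1") (auto simp: zscale_def)
qed

lemma zscale_pred: "zscale (n - 1) y = zscale n y - y"
  using zscale_succ[of "n - 1" y] by (simp add: algebra_simps)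

interpretation zmodule: module "zscale :: int \<Rightarrow> 'y::ab_group_add \<Rightarrow> 'y"
proof
  show add: "zscale (a + b) y = zscale a y + zscale b y" for a b and y :: 'y
  proof (induction a rule: int_induct[where k = 0])
    case (step1 i)
    then show ?case using zscale_succ[of "i + b" y] zscale_succ[of i y] by (simp add: algebra_simps)
  next
    case (step2 i)
    moreover have "i - 1 + b = i + b - 1" by simp
    ultimately show ?case using zscale_pred[of "i + b" y] zscale_pred[of i y] by (simp add: diff_add_eq)
  qed simp
  show "zscale a (x + y) = zscale a x + zscale a y" for a and x y :: 'y
    by (induction a rule: int_induct[where k = 0])
       (simp_all add: zscale_succ zscale_pred algebra_simps)
  show "zscale a (zscale b y) = zscale (a * b) y" for a b and y :: 'y
  proof (induction a rule: int_induct[where k = 0])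
    case (step1 i)
    then show ?case by (simp add: add distrib_right)
  next
    case (step2 i)
    have "zscale ((i - 1) * b + b) y = zscale ((i - 1) * b) y + zscale b y" by (rule add)
    with step2 show ?case by (simp add: zscale_pred algebra_simps)
  qed simp
  show "zscale 1 y = y" for y :: 'y
    by simp
qed

definition fg_free_abelian :: "'y::ab_group_add itself \<Rightarrow> bool" where
  "fg_free_abelian _ \<longleftrightarrow>
     (\<exists>B :: 'y set. finite B \<and> \<not> module.dependent zscale B \<and> module.span zscale B = UNIV)"

definition perfect_pairing :: "('y::ab_group_add \<Rightarrow> 'x::ab_group_add \<Rightarrow> int) \<Rightarrow> bool" where
  "perfect_pairing pair \<longleftrightarrow>
     (\<forall>y. additive (pair y)) \<and> (\<forall>x. additive (\<lambda>y. pair y x)) \<and>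
     bij_betw pair UNIV {h. additive h} \<and>
     bij_betw (\<lambda>x y. pair y x) UNIV {h. additive h}"

definition root_datum ::
  "('i \<Rightarrow> 'i \<Rightarrow> int) \<Rightarrow> ('y::ab_group_add \<Rightarrow> 'x::ab_group_add \<Rightarrow> int) \<Rightarrow> ('i \<Rightarrow> 'y) \<Rightarrow> ('i \<Rightarrow> 'x) \<Rightarrow> bool"
  where
  "root_datum A pair coroot sroot \<longleftrightarrow>
     fg_free_abelian TYPE('y) \<and> fg_free_abelian TYPE('x) \<and> perfect_pairing pair \<and>
     (\<forall>i j. pair (coroot i) (sroot j) = A i j)"


section \<open>Algebras\<close>

locale algebra_over = vector_space scale
  for scale :: "'k::field \<Rightarrow> 'a::ring_1 \<Rightarrow> 'a" +
  assumes scale_mult_left: "scale c x * y = scale c (x * y)"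
    and scale_mult_right: "x * scale c y = scale c (x * y)"

definition algebra_hom ::
  "('k::field \<Rightarrow> 'a::ring_1 \<Rightarrow> 'a) \<Rightarrow> ('k \<Rightarrow> 'b::ring_1 \<Rightarrow> 'b) \<Rightarrow> ('a \<Rightarrow> 'b) \<Rightarrow> bool" where
  "algebra_hom s s' h \<longleftrightarrow>
     algebra_over s \<and> algebra_over s' \<and> Vector_Spaces.linear s s' h \<and>
     h 1 = 1 \<and> (\<forall>x y. h (x * y) = h x * h y)"

definition algebra_automorphism ::
  "('k::field \<Rightarrow> 'a::ring_1 \<Rightarrow> 'a) \<Rightarrow> ('a \<Rightarrow> 'a) \<Rightarrow> bool" where
  "algebra_automorphism s h \<longleftrightarrow> algebra_hom s s h \<and> bij h"

text \<open>The free monoid, written additively as required by the class assumptions on \<open>\<Rightarrow>\<^sub>0\<close>.\<close>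

datatype 'i fword = Word (letters: "'i list")

instantiation fword :: (type) monoid_add
begin

definition zero_fword :: "'a fword" where
  "0 = Word []"

definition plus_fword :: "'a fword \<Rightarrow> 'a fword \<Rightarrow> 'a fword" where
  "v + w = Word (letters v @ letters w)"

instance
  by standard (simp_all add: zero_fword_def plus_fword_def)

end

text \<open>
  For a monoid \<open>'m\<close> and an algebra \<open>'a\<close>, the type \<open>'m \<Rightarrow>\<^sub>0 'a\<close> with the convolution product is the
  monoid algebra with coefficients in \<open>'a\<close>.
\<close>

definition pm_scale :: "('k \<Rightarrow> 'a \<Rightarrow> 'a) \<Rightarrow> 'k \<Rightarrow> ('m \<Rightarrow>\<^sub>0 'a::zero) \<Rightarrow> ('m \<Rightarrow>\<^sub>0 'a)" where
  "pm_scale s c p = Poly_Mapping.map (s c) p"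

type_synonym ('i, 'k) free_algebra = "'i fword \<Rightarrow>\<^sub>0 'k"

definition free_gen :: "'i \<Rightarrow> ('i, 'k::field) free_algebra" where
  "free_gen i = Poly_Mapping.single (Word [i]) 1"

definition free_eval ::
  "('k::field \<Rightarrow> 'a::ring_1 \<Rightarrow> 'a) \<Rightarrow> ('i \<Rightarrow> 'a) \<Rightarrow> ('i, 'k) free_algebra \<Rightarrow> 'a" where
  "free_eval s x p =
     (\<Sum>w\<in>Poly_Mapping.keys p. s (Poly_Mapping.lookup p w) (prod_list (map x (letters w))))"

definition two_sided_ideal :: "'a::ring_1 set \<Rightarrow> bool" where
  "two_sided_ideal J \<longleftrightarrow>
     0 \<in> J \<and> (\<forall>x\<in>J. \<forall>y\<in>J. x + y \<in> J) \<and> (\<forall>x\<in>J. \<forall>r. r * x \<in> J \<and> x * r \<in> J)"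

text \<open>
  The algebra \<open>'a\<close> is presented by the generators \<open>x i\<close> and the relations \<open>r = 0\<close>, \<open>r \<in> R\<close>:
  the canonical map identifies it with the free algebra modulo the two-sided ideal generated by \<open>R\<close>.
\<close>

definition presented_by ::
  "('k::field \<Rightarrow> 'a::ring_1 \<Rightarrow> 'a) \<Rightarrow> ('i \<Rightarrow> 'a) \<Rightarrow> ('i, 'k) free_algebra set \<Rightarrow> bool" where
  "presented_by s x R \<longleftrightarrow>
     algebra_over s \<and> surj (free_eval s x) \<and>
     {p. free_eval s x p = 0} = two_sided_ideal hull R"

definition serre ::
  "('i \<Rightarrow> 'i \<Rightarrow> int) \<Rightarrow> ('i \<Rightarrow> rat) \<Rightarrow> (qfield \<Rightarrow> 'a::ring_1 \<Rightarrow> 'a) \<Rightarrow> ('i \<Rightarrow> 'a) \<Rightarrow> 'i \<Rightarrow> 'i \<Rightarrow> 'a" where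
  "serre A ds s x i j =
     (\<Sum>k=0..nat (1 - A i j).
        s ((-1) ^ k * qbinom (qi ds i) (1 - A i j) k)
          (x i ^ k * x j * x i ^ (nat (1 - A i j) - k)))"

definition is_Uq_minus ::
  "('i \<Rightarrow> 'i \<Rightarrow> int) \<Rightarrow> ('i \<Rightarrow> rat) \<Rightarrow> (qfield \<Rightarrow> 'u::ring_1 \<Rightarrow> 'u) \<Rightarrow> ('i \<Rightarrow> 'u) \<Rightarrow> bool" where
  "is_Uq_minus A ds s F \<longleftrightarrow>
     presented_by s F {serre A ds (pm_scale (*)) free_gen i j |i j. i \<noteq> j}"

definition quotient_algebra ::
  "('k::field \<Rightarrow> 'u::ring_1 \<Rightarrow> 'u) \<Rightarrow> ('k \<Rightarrow> 'a::ring_1 \<Rightarrow> 'a) \<Rightarrow> ('u \<Rightarrow> 'a) \<Rightarrow> bool" where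
  "quotient_algebra su sa \<pi> \<longleftrightarrow> algebra_hom su sa \<pi> \<and> surj \<pi>"

definition algebra_filtration ::
  "('k::field \<Rightarrow> 'a::ring_1 \<Rightarrow> 'a) \<Rightarrow> (nat \<Rightarrow> 'a set) \<Rightarrow> bool" where
  "algebra_filtration s Fil \<longleftrightarrow>
     (\<forall>k. module.subspace s (Fil k)) \<and> incseq Fil \<and> (\<Union>k. Fil k) = UNIV \<and> 1 \<in> Fil 0 \<and>
     (\<forall>k l. \<forall>x\<in>Fil k. \<forall>y\<in>Fil l. x * y \<in> Fil (k + l))"

text \<open>
  The library's \<open>dim\<close> is \<open>0\<close> on spaces of infinite dimension, hence the separate finiteness condition.
\<close>

definition tempered_domain :: "('k::field \<Rightarrow> 'a::ring_1 \<Rightarrow> 'a) \<Rightarrow> bool" where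
  "tempered_domain s \<longleftrightarrow>
     algebra_over s \<and> (\<forall>x y :: 'a. x * y = 0 \<longrightarrow> x = 0 \<or> y = 0) \<and>
     (\<exists>Fil. algebra_filtration s Fil \<and>
        (\<forall>k. \<exists>B. finite B \<and> Fil k \<subseteq> module.span s B) \<and>
        limsup (\<lambda>k. ereal (real (vector_space.dim s (Fil k)) powr (1 / real k))) \<le> 1)"

text \<open>
  Right fractions \<open>a b\<inverse>\<close> are used; over a two-sided Ore domain left fractions give the same skew field.
  The skew field is unique up to a unique isomorphism compatible with the embedding \<open>\<kappa>\<close>.
\<close>

definition skew_field_of_fractions ::
  "('k::field \<Rightarrow> 'a::ring_1 \<Rightarrow> 'a) \<Rightarrow> ('k \<Rightarrow> 'q::division_ring \<Rightarrow> 'q) \<Rightarrow> ('a \<Rightarrow> 'q) \<Rightarrow> bool" where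
  "skew_field_of_fractions s sq \<kappa> \<longleftrightarrow>
     algebra_hom s sq \<kappa> \<and> inj \<kappa> \<and> (\<forall>z. \<exists>a b. b \<noteq> 0 \<and> z = \<kappa> a * inverse (\<kappa> b))"


section \<open>The torus part and the tensor product\<close>

text \<open>
  The lattice \<open>d\<^sup>-\<^sup>1 Y\<close> is identified with \<open>Y\<close> by multiplication with \<open>d\<close>: an element \<open>y\<close> of the exponent
  type \<open>'y\<close> stands for \<open>y/d\<close>. So \<open>torus y\<close> is \<open>q^(y/d)\<close>, and for \<open>\<lambda>\<close> in \<open>Y\<close> the element \<open>q^\<lambda>\<close> is
  \<open>torus (zscale d \<lambda>)\<close>.
\<close>

type_synonym 'y Uq_zero = "'y \<Rightarrow>\<^sub>0 qfield"

definition torus :: "'y \<Rightarrow> 'y Uq_zero" where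
  "torus y = Poly_Mapping.single y 1"

text \<open>
  The tensor product over the ground field of an algebra \<open>'a\<close> and the group algebra of \<open>'y\<close> is the
  group algebra \<open>'y \<Rightarrow>\<^sub>0 'a\<close>, with scalar action \<open>pm_scale s\<close> and with \<open>tens s a u\<close> as the pure tensors;
  the lemmas below give its universal property and the product of pure tensors.
\<close>

definition tens :: "('k \<Rightarrow> 'a \<Rightarrow> 'a) \<Rightarrow> 'a::zero \<Rightarrow> ('y \<Rightarrow>\<^sub>0 'k::zero) \<Rightarrow> ('y \<Rightarrow>\<^sub>0 'a)" where
  "tens s a u = Poly_Mapping.map (\<lambda>c. s c a) u"

text \<open>\<open>(q\<^sub>i^\<lambda>)^m = q^(m d\<^sub>i \<lambda>)\<close>, for integers \<open>m\<close>\<close>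

definition qi_wt :: "('i \<Rightarrow> rat) \<Rightarrow> 'i \<Rightarrow> 'y::ab_group_add \<Rightarrow> int \<Rightarrow> 'y Uq_zero" where
  "qi_wt ds i lam m = torus (zscale (m * dnum ds i) lam)"

text \<open>\<open>q\<^sub>i^(m(\<lambda>-k))\<close>\<close>

definition qi_wt_shift :: "('i \<Rightarrow> rat) \<Rightarrow> 'i \<Rightarrow> int \<Rightarrow> 'y::ab_group_add \<Rightarrow> int \<Rightarrow> 'y Uq_zero" where
  "qi_wt_shift ds i m lam k = pm_scale (*) (qi ds i powi (- (m * k))) (qi_wt ds i lam m)"

text \<open>\<open>[\<lambda>-\<nu>]\<close> and \<open>[\<lambda> choose k]\<close> at \<open>q\<^sub>i\<close>\<close>

definition qint_wt :: "('i \<Rightarrow> rat) \<Rightarrow> 'i \<Rightarrow> 'y::ab_group_add \<Rightarrow> int \<Rightarrow> 'y Uq_zero" where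
  "qint_wt ds i lam \<nu> =
     pm_scale (*) (inverse (qi ds i - inverse (qi ds i)))
       (pm_scale (*) (qi ds i powi (- \<nu>)) (qi_wt ds i lam 1)
        - pm_scale (*) (qi ds i powi \<nu>) (qi_wt ds i lam (- 1)))"

definition qbinom_wt :: "('i \<Rightarrow> rat) \<Rightarrow> 'i \<Rightarrow> 'y::ab_group_add \<Rightarrow> nat \<Rightarrow> 'y Uq_zero" where
  "qbinom_wt ds i lam k =
     pm_scale (*) (inverse (qfact (qi ds i) k)) (\<Prod>\<nu><k. qint_wt ds i lam (int \<nu>))"

text \<open>\<open>ad(x\<^sub>i)^k(x\<^sub>j)\<close>\<close>

definition ad_pow ::
  "('i \<Rightarrow> 'i \<Rightarrow> int) \<Rightarrow> ('i \<Rightarrow> rat) \<Rightarrow> (qfield \<Rightarrow> 'a::ring_1 \<Rightarrow> 'a) \<Rightarrow> ('i \<Rightarrow> 'a) \<Rightarrow> 'i \<Rightarrow> 'i \<Rightarrow> nat \<Rightarrow> 'a" where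
  "ad_pow A ds s x i j k =
     (\<Sum>\<nu>=0..k.
        s ((-1) ^ \<nu> * qi ds i powi (int \<nu> * (int k - 1 + A i j)) * qbinom (qi ds i) (int k) \<nu>)
          (x i ^ (k - \<nu>) * x j * x i ^ \<nu>))"

lemma lookup_pm_scale:
  assumes "s c 0 = 0"
  shows "Poly_Mapping.lookup (pm_scale s c p) m = s c (Poly_Mapping.lookup p m)"
  using assms by (simp add: pm_scale_def map.rep_eq when_def)

lemma lookup_tens:
  assumes "s 0 a = 0"
  shows "Poly_Mapping.lookup (tens s a u) m = s (Poly_Mapping.lookup u m) a"
  using assms by (simp add: tens_def map.rep_eq when_def)


lemma pm_induct [case_names single add]:
  fixes p :: "'m \<Rightarrow>\<^sub>0 'a::comm_monoid_add"
  assumes "\<And>m a. P (Poly_Mapping.single m a)" and "\<And>p r. P p \<Longrightarrow> P r \<Longrightarrow> P (p + r)"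
  shows "P p"
proof (induction p rule: update_induct)
  case const
  show ?case using assms(1)[of undefined 0] by simp
next
  case (update p m a)
  then have "Poly_Mapping.update m a p = Poly_Mapping.single m a + p"
    by (intro poly_mapping_eqI)
       (auto simp: lookup_update lookup_add lookup_single when_def in_keys_iff)
  then show ?case using assms update by simp
qed

lemma pm_scale_single:
  assumes "s c 0 = 0"
  shows "pm_scale s c (Poly_Mapping.single m a) = Poly_Mapping.single m (s c a)"
  using assms by (intro poly_mapping_eqI) (simp add: lookup_pm_scale lookup_single when_def)

context algebra_over
begin

lemma lookup_pm_scale' [simp]:
  "Poly_Mapping.lookup (pm_scale scale c p) m = scale c (Poly_Mapping.lookup p m)"
  by (simp add: lookup_pm_scale)

lemma lookup_tens' [simp]:
  "Poly_Mapping.lookup (tens scale a u) m = scale (Poly_Mapping.lookup u m) a"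
  by (simp add: lookup_tens)

lemma pm_scale_add: "pm_scale scale c (p + r) = pm_scale scale c p + pm_scale scale c r"
  by (intro poly_mapping_eqI) (simp add: lookup_add scale_right_distrib)

lemma pm_scale_mult_left:
  fixes p r :: "'m::monoid_add \<Rightarrow>\<^sub>0 'a"
  shows "pm_scale scale c p * r = pm_scale scale c (p * r)"
proof (induction p rule: pm_induct)
  case (single k v)
  show ?case
    by (induction r rule: pm_induct)
       (simp_all add: pm_scale_single mult_single scale_mult_left distrib_left pm_scale_add)
qed (simp add: distrib_right pm_scale_add)

lemma pm_scale_mult_right:
  fixes p r :: "'m::monoid_add \<Rightarrow>\<^sub>0 'a"
  shows "p * pm_scale scale c r = pm_scale scale c (p * r)"
proof (induction p rule: pm_induct)
  case (single k v)
  show ?case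
    by (induction r rule: pm_induct)
       (simp_all add: pm_scale_single mult_single scale_mult_right distrib_left pm_scale_add)
qed (simp add: distrib_right pm_scale_add)

lemma monoid_algebra: "algebra_over (pm_scale scale :: _ \<Rightarrow> ('m::monoid_add \<Rightarrow>\<^sub>0 'a) \<Rightarrow> _)"
  by unfold_locales
     (auto intro!: poly_mapping_eqI simp: pm_scale_mult_left pm_scale_mult_right lookup_add
        scale_right_distrib scale_left_distrib)

lemma tens_add_left: "tens scale (a + b) u = tens scale a u + tens scale b u"
  by (intro poly_mapping_eqI) (simp add: lookup_add scale_right_distrib)

lemma tens_add_right: "tens scale a (u + v) = tens scale a u + tens scale a v"
  by (intro poly_mapping_eqI) (simp add: lookup_add scale_left_distrib)

lemma tens_single: "tens scale a (Poly_Mapping.single m c) = Poly_Mapping.single m (scale c a)"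
  by (intro poly_mapping_eqI) (simp add: lookup_single when_def)

lemma tens_one: "tens scale 1 1 = 1"
  using tens_single[of 1 0 1] by simp

lemma tens_mult:
  fixes u v :: "'m::monoid_add \<Rightarrow>\<^sub>0 'k"
  shows "tens scale a u * tens scale b v = tens scale (a * b) (u * v)"
proof (induction u rule: pm_induct)
  case (single k c)
  show ?case
    by (induction v rule: pm_induct)
       (simp_all add: tens_single mult_single scale_mult_left scale_mult_right distrib_left
          tens_add_right mult.commute)
qed (simp add: distrib_right tens_add_right)

lemma tens_scale_right: "tens scale a (pm_scale (*) c u) = pm_scale scale c (tens scale a u)"
  by (intro poly_mapping_eqI) (simp add: lookup_pm_scale)

lemma tens_scale_left: "tens scale (scale c a) u = pm_scale scale c (tens scale a u)"
  by (intro poly_mapping_eqI) (simp add: mult.commute)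

lemma tensor_universal_property:
  fixes \<beta> :: "'a \<Rightarrow> ('m::monoid_add \<Rightarrow>\<^sub>0 'k) \<Rightarrow> 'w::ab_group_add"
  assumes left: "\<And>u. Vector_Spaces.linear scale sw (\<lambda>a. \<beta> a u)"
    and right: "\<And>a. Vector_Spaces.linear (pm_scale (*)) sw (\<beta> a)"
  shows "\<exists>!h. Vector_Spaces.linear (pm_scale scale) sw h \<and> (\<forall>a u. h (tens scale a u) = \<beta> a u)"
proof -
  interpret sw: vector_space sw
    using left by (simp add: Vector_Spaces.linear_def)
  interpret pm: algebra_over "pm_scale scale :: _ \<Rightarrow> ('m \<Rightarrow>\<^sub>0 'a) \<Rightarrow> _"
    by (rule monoid_algebra)
  have add_l: "\<beta> (a + b) u = \<beta> a u + \<beta> b u" and scale_l: "\<beta> (scale c a) u = sw c (\<beta> a u)"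
    and add_r: "\<beta> a (u + v) = \<beta> a u + \<beta> a v" and scale_r: "\<beta> a (pm_scale (*) c u) = sw c (\<beta> a u)"
    for a b c u v
    using left[of u] right[of a]
    by (simp_all add: Vector_Spaces.linear_def module_hom_def module_hom_axioms_def)
  have zero_l: "\<beta> 0 u = 0" for u
    using scale_l[of 0 0 u] by simp
  define h where "h p = (\<Sum>m\<in>Poly_Mapping.keys p. \<beta> (Poly_Mapping.lookup p m) (Poly_Mapping.single m 1))"
    for p :: "'m \<Rightarrow>\<^sub>0 'a"
  have h_sub: "h p = (\<Sum>m\<in>S. \<beta> (Poly_Mapping.lookup p m) (Poly_Mapping.single m 1))"
    if "finite S" "Poly_Mapping.keys p \<subseteq> S" for p S
    unfolding h_def using that
    by (intro sum.mono_neutral_left) (auto simp: in_keys_iff zero_l)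
  have h_add: "h (p + r) = h p + h r" for p r
  proof -
    let ?S = "Poly_Mapping.keys p \<union> Poly_Mapping.keys r"
    have "h (p + r) = (\<Sum>m\<in>?S. \<beta> (Poly_Mapping.lookup (p + r) m) (Poly_Mapping.single m 1))"
      by (rule h_sub) (auto simp: Poly_Mapping.keys_add)
    then show ?thesis
      by (simp add: h_sub[of ?S p] h_sub[of ?S r] lookup_add add_l sum.distrib)
  qed
  have h_scale: "h (pm_scale scale c p) = sw c (h p)" for c p
  proof -
    have "h (pm_scale scale c p)
      = (\<Sum>m\<in>Poly_Mapping.keys p. \<beta> (Poly_Mapping.lookup (pm_scale scale c p) m) (Poly_Mapping.single m 1))"
      by (rule h_sub) (auto simp: in_keys_iff)
    then show ?thesis
      by (simp add: h_def scale_l sw.scale_sum_right)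
  qed
  have lin: "Vector_Spaces.linear (pm_scale scale) sw h"
    by unfold_locales (simp_all add: h_add h_scale)
  have h_single: "h (Poly_Mapping.single m a) = \<beta> a (Poly_Mapping.single m 1)" for m a
    by (simp add: h_def zero_l)
  have tens: "h (tens scale a u) = \<beta> a u" for a u
  proof (induction u rule: pm_induct)
    case (single m c)
    have "pm_scale (*) c (Poly_Mapping.single m 1) = (Poly_Mapping.single m c :: 'm \<Rightarrow>\<^sub>0 'k)"
      by (simp add: pm_scale_single)
    then show ?case
      using scale_r[of a c "Poly_Mapping.single m 1"] by (simp add: tens_single h_single scale_l)
  qed (simp add: tens_add_right h_add add_r)
  have uniq: "h' = h"
    if "Vector_Spaces.linear (pm_scale scale) sw h'" and t: "\<forall>a u. h' (tens scale a u) = \<beta> a u" for h'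
  proof
    fix p
    have h'_add: "h' (p + r) = h' p + h' r" for p r
      using that(1) by (simp add: Vector_Spaces.linear_def module_hom_def module_hom_axioms_def)
    show "h' p = h p"
    proof (induction p rule: pm_induct)
      case (single m a)
      show ?case
        using t[rule_format, of a "Poly_Mapping.single m 1"] by (simp add: tens_single h_single)
    qed (simp add: h'_add h_add)
  qed
  show ?thesis
    using lin tens uniq by blast
qed

end

end

(*
  Let c be conjugation by f_i. By the q-binomial theorem the elements E_k = ad(f_i)^k(f_j) f_i^(-k)
  satisfy E_(k+1) = (c - q_i^(a_ij + 2k)) E_k, and the q-Serre relation says E_(1 - a_ij) = 0. Hence
  f_j is a sum of eigenvectors y_r of c with the distinct eigenvalues q_i^(a_ij + 2r),
  0 <= r <= -a_ij. Conjugation by f_i^n multiplies y_r by q_i^(n(a_ij + 2r)), and Newton interpolation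
  at the points q_i^(a_ij + 2r) rewrites the result in terms of the E_k.

  The relations of the quotient algebra other than the Serre relations are unknown, but they do not
  matter: the sums of eigenvectors of c in Q(A_q) form a subring graded by weights, and multiplying
  the part of weight m by the central element q_i^(m lambda) is an automorphism of it. This subring
  contains A_q, so the automorphism extends to the skew field of fractions. The interpolation identity,
  now with q_i^lambda in place of q_i^n, gives its value on f_j.
*)
theory Submission
  imports Defs
begin

section \<open>q-binomial coefficients\<close>

text \<open>Since \<open>v\<close> is not a root of unity, q-integers of nonzero integers and
  differences of distinct powers of \<open>v\<close> can be inverted.\<close>

locale generic_param =
  fixes v :: "'k::field"
  assumes v_nonzero: "v \<noteq> 0" and v_generic: "v powi m = 1 \<Longrightarrow> m = 0"
begin

lemma powi_inj: "v powi m = v powi n \<longleftrightarrow> m = n"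
proof
  assume "v powi m = v powi n"
  then have "v powi (m - n) = 1"
    using v_nonzero by (simp add: power_int_diff)
  then show "m = n" using v_generic by fastforce
qed simp

lemma v_minus_inverse_nonzero: "v - inverse v \<noteq> 0"
  using powi_inj[of 1 "-1"] by (simp add: power_int_minus)

lemma qint_nonzero: "x \<noteq> 0 \<Longrightarrow> qint v x \<noteq> 0"
  using powi_inj[of x "-x"] v_minus_inverse_nonzero by (simp add: qint_def)

lemma qfact_Suc: "qfact v (Suc k) = qfact v k * qint v (int k + 1)"
  by (simp add: qfact_def add.commute)

lemma qfact_nonzero: "qfact v k \<noteq> 0"
  by (simp add: qfact_def qint_nonzero)

lemma qbinom_0 [simp]: "qbinom v x 0 = 1"
  by (simp add: qbinom_def qfact_def)

lemma qbinom_Suc: "qbinom v x (Suc k) = qbinom v x k * qint v (x - int k) / qint v (int k + 1)"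
  by (simp add: qbinom_def qfact_Suc)

lemma qbinom_eq_0: "k < l \<Longrightarrow> qbinom v (int k) l = 0"
  by (auto simp: qbinom_def qint_def intro!: exI[of _ k])

text \<open>After clearing \<open>v - inverse v\<close> the two mixed powers on the right cancel.
  Replacing \<open>v\<close> by its inverse exchanges the two forms.\<close>

lemma qint_split:
  "qint v (x + 1) = v powi (k - x) * qint v (k + 1) + v powi (k + 1) * qint v (x - k)"
  "qint v (x + 1) = v powi (x - k) * qint v (k + 1) + v powi (- k - 1) * qint v (x - k)"
  using v_nonzero v_minus_inverse_nonzero
  by (simp_all add: qint_def right_diff_distrib add.commute flip: power_int_add add_divide_distrib)

text \<open>Both come from splitting the top factor \<open>qint v (x + 1)\<close>. The first form
  serves the interpolation identity, the second the recursion for \<open>ad_pow\<close>.\<close>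

lemma qbinom_pascal:
  "qbinom v (x + 1) (Suc k)
     = v powi (int k - x) * qbinom v x k + v powi (int k + 1) * qbinom v x (Suc k)"
  "qbinom v (x + 1) (Suc k)
     = v powi (x - int k) * qbinom v x k + v powi (- int k - 1) * qbinom v x (Suc k)"
proof -
  have *: "qbinom v (x + 1) (Suc k) = qbinom v x k * qint v (x + 1) / qint v (int k + 1)"
    unfolding qbinom_def by (subst prod.lessThan_Suc_shift) (simp add: qfact_Suc)
  have nz: "qint v (int k + 1) \<noteq> 0" by (simp add: qint_nonzero)
  show "qbinom v (x + 1) (Suc k)
     = v powi (int k - x) * qbinom v x k + v powi (int k + 1) * qbinom v x (Suc k)"
    unfolding *
    unfolding qbinom_Suc qint_split(1)[of x "int k"] using nz by (simp add: field_simps)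
  show "qbinom v (x + 1) (Suc k)
     = v powi (x - int k) * qbinom v x k + v powi (- int k - 1) * qbinom v x (Suc k)"
    unfolding *
    unfolding qbinom_Suc qint_split(2)[of x "int k"] using nz by (simp add: field_simps)
qed

lemma prod_qint_mult_qfact:
  "k \<le> n \<Longrightarrow> (\<Prod>\<nu><k. qint v (int n - int \<nu>)) * qfact v (n - k) = qfact v n"
proof (induction k)
  case (Suc k)
  then have "qfact v (n - k) = qfact v (n - Suc k) * qint v (int n - int k)"
    using qfact_Suc[of "n - Suc k"] by (simp add: Suc_diff_Suc of_nat_diff)
  with Suc show ?case by (simp add: mult_ac)
qed simp

text \<open>Both sides are \<open>qfact v n\<close> divided by
  \<open>qfact v k * qfact v (n - k)\<close>.\<close>

lemma qbinom_symmetric: "k \<le> n \<Longrightarrow> qbinom v (int n) (n - k) = qbinom v (int n) k"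
  using prod_qint_mult_qfact[of k n] prod_qint_mult_qfact[of "n - k" n]
  by (simp add: qbinom_def qfact_nonzero field_simps)

end

section \<open>Newton interpolation at powers of v\<close>

text \<open>
  \<open>P m\<close> plays the role of \<open>v\<^sup>m\<^sup>\<lambda>\<close>: it is \<open>v powi (n * m)\<close> for an integer \<open>\<lambda> = n\<close>, and a torus element for \<open>\<lambda>\<close> in \<open>Y\<close>.
\<close>

definition weight_coeff ::
  "('k::field \<Rightarrow> 'r::comm_ring_1 \<Rightarrow> 'r) \<Rightarrow> 'k \<Rightarrow> (int \<Rightarrow> 'r) \<Rightarrow> int \<Rightarrow> nat \<Rightarrow> 'r" where
  "weight_coeff s v P a k =
     s (v powi (- ((int k + a) * int k))) (P (int k + a)) *
     s (inverse (qfact v k))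
       (\<Prod>\<nu><k. s (inverse (v - inverse v)) (s (v powi (- int \<nu>)) (P 1) - s (v powi int \<nu>) (P (- 1))))"

lemma weight_coeff_sum:
  fixes s :: "'k::field \<Rightarrow> 'r::comm_ring_1 \<Rightarrow> 'r"
  assumes "generic_param v" and "algebra_over s"
    and P0: "P 0 = 1" and P_add: "\<And>m n. P (m + n) = P m * P n" and "r \<le> M"
  shows "(\<Sum>k\<le>M. s (\<Prod>\<nu><k. v powi (a + 2 * int r) - v powi (a + 2 * int \<nu>))
            (weight_coeff s v P a k)) = P (a + 2 * int r)"
proof -
  \<comment> \<open>Rewritten in the elements \<open>N k\<close>, this is Cauchy's expansion of \<open>Y\<^sup>r\<close>, \<open>Y = P 2\<close>, in the polynomials
    \<open>\<Prod>\<nu><k. Y - v\<^bsup>2\<nu>\<^esup>\<close>; its coefficients \<open>\<beta> r k\<close> are Gaussian binomials in \<open>v\<^sup>2\<close>.\<close>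
  interpret generic_param v by fact
  interpret algebra_over s by fact
  define N where "N k = P a * (\<Prod>\<nu><k. P 2 - s (v powi (2 * int \<nu>)) 1)" for k
  define e where "e r k = (\<Prod>\<nu><k. v powi (a + 2 * int r) - v powi (a + 2 * int \<nu>))" for r k
  define \<beta> where "\<beta> r k = v powi (int k * (int r - int k)) * qbinom v (int r) k" for r k
  \<comment> \<open>Both sides acquire the scalar \<open>\<delta> * w\<close> and the factor
    \<open>Z\<close> when \<open>k\<close> grows by one.\<close>
  have wt: "s (e r k) (weight_coeff s v P a k) = s (\<beta> r k) (N k)" for r k
  proof (induction k)
    case 0
    then show ?case
      by (simp add: e_def \<beta>_def N_def weight_coeff_def qfact_def)
  next
    case (Suc k)
    \<comment> \<open>The exponent is the increment -2k-1-a of -(k+a)k plus the -k released by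
      \<open>fac\<close>.\<close>
    define w where
      "w = v powi (- 3 * int k - 1 - a) * inverse (qint v (int k + 1)) * inverse (v - inverse v)"
    define Z where "Z = P 2 - s (v powi (2 * int k)) 1"
    have P1: "P 2 = P 1 * P 1" "P 1 * P (- 1) = 1" "P (int (Suc k) + a) = P (int k + a) * P 1"
      using P0 by (simp_all add: algebra_simps flip: P_add)
    \<comment> \<open>The extra \<open>P 1\<close>, from the weight k+a rising by one, turns the
      numerator of the new q-integer into a linear factor in \<open>P 2\<close>.\<close>
    have fac: "P 1 * (s (v powi (- int k)) (P 1) - s (v powi int k) (P (- 1))) = s (v powi (- int k)) Z"
      using P1 v_nonzero
      by (simp add: Z_def right_diff_distrib scale_right_diff_distrib scale_mult_right flip: power_int_add)
    have exps: "v powi (- ((int (Suc k) + a) * int (Suc k))) * v powi (- int k)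
      = v powi (- ((int k + a) * int k)) * v powi (- 3 * int k - 1 - a)"
    proof -
      have "- ((int (Suc k) + a) * int (Suc k)) + - int k
        = - ((int k + a) * int k) + (- 3 * int k - 1 - a)"
        by (simp add: algebra_simps)
      then show ?thesis
        by (simp only: power_int_add[OF disjI1[OF v_nonzero], symmetric])
    qed
    define L where "L = (\<Prod>\<nu><k. s (inverse (v - inverse v))
        (s (v powi (- int \<nu>)) (P 1) - s (v powi int \<nu>) (P (- 1))))"
    have "weight_coeff s v P a (Suc k)
      = s (v powi (- ((int (Suc k) + a) * int (Suc k))) * inverse (qfact v (Suc k)) * inverse (v - inverse v))
          (P (int k + a) * L * (P 1 * (s (v powi (- int k)) (P 1) - s (v powi int k) (P (- 1)))))"
      unfolding weight_coeff_def P1(3) by (simp add: scale_mult_left scale_mult_right L_def mult_ac)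
    also have "\<dots> = s (v powi (- ((int (Suc k) + a) * int (Suc k))) * v powi (- int k)
          * inverse (qfact v (Suc k)) * inverse (v - inverse v)) (P (int k + a) * L * Z)"
      unfolding fac by (simp add: scale_mult_right mult_ac)
    also have "\<dots> = s w (weight_coeff s v P a k * Z)"
      unfolding exps weight_coeff_def L_def[symmetric] qfact_Suc w_def
      by (simp add: scale_mult_left scale_mult_right mult_ac)
    finally have c1: "weight_coeff s v P a (Suc k) = s w (weight_coeff s v P a k * Z)" .
    define \<delta> where "\<delta> = v powi (a + 2 * int r) - v powi (a + 2 * int k)"
    have c2: "e r (Suc k) = e r k * \<delta>"
      by (simp add: e_def \<delta>_def)
    have "(v powi (a + 2 * int r) - v powi (a + 2 * int k)) * v powi (- 3 * int k - 1 - a)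
      = v powi (int r - 2 * int k - 1) * (v powi (int r - int k) - v powi (- (int r - int k)))"
      using v_nonzero by (simp add: algebra_simps flip: power_int_add)
    then have c3: "\<delta> * w
      = v powi (int r - 2 * int k - 1) * (qint v (int r - int k) / qint v (int k + 1))"
      unfolding \<delta>_def w_def qint_def[of v "int r - int k"] by (simp add: divide_inverse)
    have "v powi (int (Suc k) * (int r - int (Suc k)))
      = v powi (int k * (int r - int k)) * v powi (int r - 2 * int k - 1)"
      using v_nonzero by (simp add: algebra_simps flip: power_int_add)
    then have c4: "\<beta> r (Suc k) = \<beta> r k * (\<delta> * w)"
      unfolding \<beta>_def c3 qbinom_Suc by simp
    have N: "N (Suc k) = N k * Z"
      by (simp add: N_def Z_def mult_ac)
    have "s (e r (Suc k)) (weight_coeff s v P a (Suc k))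
      = s (\<delta> * w) (s (e r k) (weight_coeff s v P a k) * Z)"
      unfolding c1 c2 by (simp add: scale_mult_left scale_mult_right mult_ac)
    then show ?case
      unfolding Suc c4 N by (simp add: scale_mult_left scale_mult_right mult_ac)
  qed
  have N_Suc: "N k * P 2 = N (Suc k) + s (v powi (2 * int k)) (N k)" for k
    by (simp add: N_def algebra_simps scale_mult_left scale_mult_right)
  have "(\<Sum>k\<le>r. s (\<beta> r k) (N k)) = P (a + 2 * int r)" for r
  proof (induction r)
    case 0
    then show ?case by (simp add: \<beta>_def N_def)
  next
    case (Suc r)
    have pas: "\<beta> (Suc r) (Suc k) = \<beta> r k + v powi (2 * int (Suc k)) * \<beta> r (Suc k)" for k
    proof -
      have "v powi (int (Suc k) * (int (Suc r) - int (Suc k))) * v powi (int k - int r) = v powi (int k * (int r - int k))"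
        "v powi (int (Suc k) * (int (Suc r) - int (Suc k))) * v powi (int k + 1)
          = v powi (2 * int (Suc k)) * v powi (int (Suc k) * (int r - int (Suc k)))"
        using v_nonzero by (simp_all add: algebra_simps flip: power_int_add)
      moreover have "qbinom v (int (Suc r)) (Suc k) = v powi (int k - int r) * qbinom v (int r) k
          + v powi (int k + 1) * qbinom v (int r) (Suc k)"
        using qbinom_pascal(1)[of "int r" k] by (simp add: add.commute)
      ultimately show ?thesis
        by (simp add: \<beta>_def distrib_left flip: mult.assoc)
    qed
    have top: "\<beta> r (Suc r) = 0" by (simp add: \<beta>_def qbinom_eq_0)
    have "P (a + 2 * int (Suc r)) = P 2 * P (a + 2 * int r)"
      by (simp add: algebra_simps flip: P_add)
    also have "\<dots> = (\<Sum>k\<le>r. s (\<beta> r k) (N (Suc k)) + s (v powi (2 * int k) * \<beta> r k) (N k))"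
      unfolding Suc[symmetric] sum_distrib_left
      by (intro sum.cong refl) (simp add: scale_mult_right N_Suc scale_right_distrib mult.commute)
    \<comment> \<open>The vanishing top coefficient lets the second sum reach \<open>Suc r\<close>,
      so that \<open>pas\<close> can collect the coefficient of each \<open>N k\<close>.\<close>
    also have "\<dots> = (\<Sum>k\<le>r. s (\<beta> r k) (N (Suc k))) + (\<Sum>k\<le>Suc r. s (v powi (2 * int k) * \<beta> r k) (N k))"
      by (simp add: sum.distrib top)
    also have "\<dots> = (\<Sum>k\<le>Suc r. s (\<beta> (Suc r) k) (N k))"
      unfolding sum.atMost_Suc_shift[where n = r] pas scale_left_distrib sum.distrib
      by (simp add: \<beta>_def)
    finally show ?case by simp
  qed
  then have "P (a + 2 * int r) = (\<Sum>k\<le>r. s (\<beta> r k) (N k))" by simp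
  also have "\<dots> = (\<Sum>k\<le>M. s (\<beta> r k) (N k))"
    using \<open>r \<le> M\<close> by (intro sum.mono_neutral_left) (auto simp: \<beta>_def qbinom_eq_0)
  finally show ?thesis by (simp add: wt[unfolded e_def])
qed


section \<open>Algebra homomorphisms\<close>

lemma algebra_hom_simps:
  assumes "algebra_hom s s' h"
  shows "h (x + y) = h x + h y" "h (x - y) = h x - h y" "h 0 = 0" "h 1 = 1"
    "h (x * y) = h x * h y" "h (s c x) = s' c (h x)" "h (x ^ n) = h x ^ n" "h (sum w S) = (\<Sum>z\<in>S. h (w z))"
proof -
  have lin: "Vector_Spaces.linear s s' h" and m: "h 1 = 1" "\<And>x y. h (x * y) = h x * h y"
    using assms by (auto simp: algebra_hom_def)
  interpret Vector_Spaces.linear s s' h by (rule lin)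
  show "h (x + y) = h x + h y" "h (x - y) = h x - h y" "h 0 = 0" "h 1 = 1"
    "h (x * y) = h x * h y" "h (s c x) = s' c (h x)" "h (sum w S) = (\<Sum>z\<in>S. h (w z))"
    by (simp_all add: add diff zero scale m sum)
  show "h (x ^ n) = h x ^ n" by (induction n) (simp_all add: m)
qed

lemma algebra_homI:
  assumes "algebra_over s" "algebra_over s'"
    and "\<And>x y. h (x + y) = h x + h y" "\<And>c x. h (s c x) = s' c (h x)"
    and "h 1 = 1" "\<And>x y. h (x * y) = h x * h y"
  shows "algebra_hom s s' h"
proof -
  interpret a: algebra_over s by fact
  interpret b: algebra_over s' by fact
  have "Vector_Spaces.linear s s' h"
    by unfold_locales (simp_all add: assms)
  with assms show ?thesis by (simp add: algebra_hom_def)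
qed

lemma algebra_hom_comp:
  "algebra_hom s s' h \<Longrightarrow> algebra_hom s' s'' k \<Longrightarrow> algebra_hom s s'' (\<lambda>x. k (h x))"
  by (intro algebra_homI) (simp_all add: algebra_hom_simps, simp_all add: algebra_hom_def)

lemma algebra_hom_serre:
  "algebra_hom s s' h \<Longrightarrow> h (serre A ds s x i j) = serre A ds s' (\<lambda>j. h (x j)) i j"
  by (simp add: serre_def algebra_hom_simps)

lemma algebra_hom_ad_pow:
  "algebra_hom s s' h \<Longrightarrow> h (ad_pow A ds s x i j k) = ad_pow A ds s' (\<lambda>j. h (x j)) i j k"
  by (simp add: ad_pow_def algebra_hom_simps)

lemma algebra_over_field: "algebra_over ((*) :: 'k::field \<Rightarrow> 'k \<Rightarrow> 'k)"
  by unfold_locales (simp_all add: algebra_simps)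

section \<open>Evaluation of the free algebra, and pure tensors\<close>

context algebra_over
begin

lemma free_eval_single: "free_eval scale x (Poly_Mapping.single w c) = scale c (prod_list (map x (letters w)))"
  by (simp add: free_eval_def)

lemma free_eval_superset:
  assumes "finite S" "Poly_Mapping.keys p \<subseteq> S"
  shows "free_eval scale x p = (\<Sum>w\<in>S. scale (Poly_Mapping.lookup p w) (prod_list (map x (letters w))))"
  unfolding free_eval_def using assms by (intro sum.mono_neutral_left) (auto simp: in_keys_iff)

lemma free_eval_add: "free_eval scale x (p + r) = free_eval scale x p + free_eval scale x r"
proof -
  let ?S = "Poly_Mapping.keys p \<union> Poly_Mapping.keys r"
  have "free_eval scale x (p + r)
    = (\<Sum>w\<in>?S. scale (Poly_Mapping.lookup (p + r) w) (prod_list (map x (letters w))))"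
    by (rule free_eval_superset) (auto simp: Poly_Mapping.keys_add)
  then show ?thesis
    by (simp add: free_eval_superset[of ?S p] free_eval_superset[of ?S r] lookup_add
        scale_left_distrib sum.distrib)
qed

lemma algebra_hom_free_eval: "algebra_hom (pm_scale (*)) scale (free_eval scale x)"
proof (rule algebra_homI)
  interpret k: algebra_over "(*) :: 'k \<Rightarrow> 'k \<Rightarrow> 'k" by (rule algebra_over_field)
  show "algebra_over (pm_scale (*) :: 'k \<Rightarrow> ('b, 'k) free_algebra \<Rightarrow> _)"
    by (rule k.monoid_algebra)
  show "algebra_over scale" ..
  show "free_eval scale x (pm_scale (*) c p) = scale c (free_eval scale x p)" for c p
    by (induction p rule: pm_induct)
      (simp_all add: pm_scale_single free_eval_single free_eval_add k.pm_scale_add scale_right_distrib)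
  show "free_eval scale x 1 = 1"
  proof -
    have "letters (0 :: 'b fword) = []" by (simp add: zero_fword_def)
    then show ?thesis using free_eval_single[of x 0 1] by simp
  qed
  show "free_eval scale x (p * r) = free_eval scale x p * free_eval scale x r" for p r
  proof (induction p rule: pm_induct)
    case (single w c)
    show ?case
      by (induction r rule: pm_induct)
        (simp_all add: mult_single free_eval_single free_eval_add distrib_left plus_fword_def
          scale_mult_left scale_mult_right mult.commute)
  qed (simp add: distrib_right free_eval_add)
qed (rule free_eval_add)

lemma free_eval_free_gen: "free_eval scale x (free_gen i) = x i"
  by (simp add: free_gen_def free_eval_single)

text \<open>Monomials grow one letter at a time on the left, so left multiplication by generators
  replaces closure under arbitrary products.\<close>

lemma free_eval_induct:
  assumes "surj (free_eval scale x)" and one: "P 1"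
    and gen: "\<And>i b. P b \<Longrightarrow> P (x i * b)" and scale: "\<And>c b. P b \<Longrightarrow> P (scale c b)"
    and add: "\<And>b b'. P b \<Longrightarrow> P b' \<Longrightarrow> P (b + b')"
  shows "P a"
proof -
  have "P (free_eval scale x p)" for p
  proof (induction p rule: pm_induct)
    case (single w c)
    have "P (prod_list (map x l))" for l
      by (induction l) (simp_all add: one gen)
    then show ?case by (simp add: free_eval_single scale)
  qed (simp add: free_eval_add add)
  with assms(1) show ?thesis by (metis surjD)
qed

lemma algebra_hom_tens_left: "algebra_hom scale (pm_scale scale) (\<lambda>a. tens scale a (1 :: 'm::monoid_add \<Rightarrow>\<^sub>0 'k))"
  by (intro algebra_homI monoid_algebra)
    (simp_all add: tens_add_left tens_scale_left tens_one tens_mult algebra_over_axioms)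

lemma algebra_hom_tens_right:
  "algebra_hom (pm_scale (*)) (pm_scale scale) (tens scale 1 :: ('m::monoid_add \<Rightarrow>\<^sub>0 'k) \<Rightarrow> _)"
  by (intro algebra_homI monoid_algebra algebra_over.monoid_algebra algebra_over_field)
    (simp_all add: tens_add_right tens_scale_right tens_one tens_mult algebra_over_axioms)

text \<open>Exponents commute and scalars are central, so a comparison of pure tensors
  suffices.\<close>

lemma tens_one_central:
  fixes u :: "'m::comm_monoid_add \<Rightarrow>\<^sub>0 'k"
  shows "tens scale 1 u * p = p * tens scale 1 u"
proof (induction p rule: pm_induct)
  case (single m a)
  have "tens scale 1 u * tens scale a (Poly_Mapping.single m 1)
    = tens scale a (Poly_Mapping.single m 1) * tens scale 1 u"
    by (simp add: tens_mult mult.commute)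
  then show ?case by (simp add: tens_single)
qed (simp add: distrib_left distrib_right)

end

text \<open>The Serre element of the free algebra lies in the defining ideal, which is the kernel of
  evaluation.\<close>

lemma serre_presented:
  assumes "is_Uq_minus A ds s F" and "i \<noteq> j"
  shows "serre A ds s F i j = 0"
proof -
  have pres: "algebra_over s" "{p. free_eval s F p = 0}
      = two_sided_ideal hull {serre A ds (pm_scale (*)) free_gen i j |i j. i \<noteq> j}"
    using assms(1) by (auto simp: is_Uq_minus_def presented_by_def)
  interpret algebra_over s by (rule pres)
  have "serre A ds (pm_scale (*)) free_gen i j \<in> {p. free_eval s F p = 0}"
    unfolding pres(2) using assms(2) by (intro hull_inc) auto
  then show ?thesis
    using algebra_hom_serre[OF algebra_hom_free_eval, of F A ds free_gen i j]
    by (simp add: free_eval_free_gen)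
qed


section \<open>Iterated q-commutators\<close>

text \<open>Comparing the coefficients of x_i^(k+1-\<nu>) x_j x_i^\<nu> leaves a q-Pascal
  rule.\<close>

lemma ad_pow_Suc:
  fixes s :: "qfield \<Rightarrow> 'a::ring_1 \<Rightarrow> 'a"
  assumes "algebra_over s" and "generic_param (qi ds i)"
  shows "ad_pow A ds s x i j (Suc k) = x i * ad_pow A ds s x i j k
    - s (qi ds i powi (A i j + 2 * int k)) (ad_pow A ds s x i j k * x i)"
proof -
  interpret algebra_over s by fact
  define v where "v = qi ds i"
  interpret generic_param v unfolding v_def by fact
  define \<alpha> where "\<alpha> k \<nu> = (-1) ^ \<nu> * v powi (int \<nu> * (int k - 1 + A i j)) * qbinom v (int k) \<nu>" for k \<nu>
  define X where "X k \<nu> = x i ^ (k - \<nu>) * x j * x i ^ \<nu>" for k \<nu>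
  have ad: "ad_pow A ds s x i j k = (\<Sum>\<nu>\<le>k. s (\<alpha> k \<nu>) (X k \<nu>))" for k
    by (simp add: ad_pow_def \<alpha>_def X_def v_def atMost_atLeast0)
  have \<alpha>_0: "\<alpha> k 0 = 1" "\<alpha> k (Suc k) = 0" for k
    by (simp_all add: \<alpha>_def qbinom_eq_0)
  \<comment> \<open>Once the common power \<open>p\<close> is factored out, this is the second form
    of \<open>qbinom_pascal\<close>.\<close>
  have \<alpha>_Suc: "\<alpha> (Suc k) (Suc \<nu>) = \<alpha> k (Suc \<nu>) - v powi (A i j + 2 * int k) * \<alpha> k \<nu>" for \<nu>
  proof -
    define p where "p = v powi (int (Suc \<nu>) * (int (Suc k) - 1 + A i j))"
    have 1: "v powi (int (Suc \<nu>) * (int k - 1 + A i j)) = p * v powi (- int \<nu> - 1)"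
      using v_nonzero by (simp add: p_def algebra_simps flip: power_int_add)
    have "A i j + 2 * int k + int \<nu> * (int k - 1 + A i j)
      = int (Suc \<nu>) * (int (Suc k) - 1 + A i j) + (int k - int \<nu>)"
      by (simp add: algebra_simps)
    then have 2: "v powi (A i j + 2 * int k) * v powi (int \<nu> * (int k - 1 + A i j)) = p * v powi (int k - int \<nu>)"
      unfolding p_def by (simp only: power_int_add[OF disjI1[OF v_nonzero], symmetric])
    have 3: "qbinom v (int (Suc k)) (Suc \<nu>) = v powi (int k - int \<nu>) * qbinom v (int k) \<nu>
        + v powi (- int \<nu> - 1) * qbinom v (int k) (Suc \<nu>)"
      using qbinom_pascal(2)[of "int k" \<nu>] by (simp add: add.commute)
    have "v powi (A i j + 2 * int k) * \<alpha> k \<nu>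
      = (-1) ^ \<nu> * (v powi (A i j + 2 * int k) * v powi (int \<nu> * (int k - 1 + A i j))) * qbinom v (int k) \<nu>"
      by (simp add: \<alpha>_def)
    then show ?thesis
      unfolding 2 unfolding \<alpha>_def 1 3 p_def[symmetric] by (simp add: algebra_simps)
  qed
  have "x i * ad_pow A ds s x i j k = (\<Sum>\<nu>\<le>k. s (\<alpha> k \<nu>) (X (Suc k) \<nu>))"
    unfolding ad sum_distrib_left
    by (intro sum.cong refl) (simp add: scale_mult_right X_def Suc_diff_le mult.assoc)
  also have "\<dots> = (\<Sum>\<nu>\<le>Suc k. s (\<alpha> k \<nu>) (X (Suc k) \<nu>))"
    by (simp add: \<alpha>_0)
  also have "\<dots> = X (Suc k) 0 + (\<Sum>\<nu>\<le>k. s (\<alpha> k (Suc \<nu>)) (X (Suc k) (Suc \<nu>)))"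
    by (simp add: sum.atMost_Suc_shift \<alpha>_0 del: sum.atMost_Suc)
  finally have 1: "x i * ad_pow A ds s x i j k = \<dots>" .
  have "ad_pow A ds s x i j k * x i = (\<Sum>\<nu>\<le>k. s (\<alpha> k \<nu>) (X (Suc k) (Suc \<nu>)))"
    unfolding ad sum_distrib_right
    by (intro sum.cong refl) (simp add: scale_mult_left X_def mult.assoc power_commutes)
  then have 2: "s (v powi (A i j + 2 * int k)) (ad_pow A ds s x i j k * x i)
      = (\<Sum>\<nu>\<le>k. s (v powi (A i j + 2 * int k) * \<alpha> k \<nu>) (X (Suc k) (Suc \<nu>)))"
    by (simp add: scale_sum_right)
  have "ad_pow A ds s x i j (Suc k) = X (Suc k) 0 + (\<Sum>\<nu>\<le>k. s (\<alpha> (Suc k) (Suc \<nu>)) (X (Suc k) (Suc \<nu>)))"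
    unfolding ad by (simp add: sum.atMost_Suc_shift \<alpha>_0 del: sum.atMost_Suc)
  with 1 2 show ?thesis
    by (simp add: \<alpha>_Suc scale_left_diff_distrib sum_subtractf v_def)
qed

text \<open>At k = 1 - a_ij the power of q_i in \<open>ad_pow\<close> is trivial because k - 1 +
  a_ij = 0. Reversing the sum then matches the Serre sum up to a sign.\<close>

lemma serre_eq_ad_pow:
  fixes s :: "qfield \<Rightarrow> 'a::ring_1 \<Rightarrow> 'a"
  assumes "algebra_over s" and "generic_param (qi ds i)" and "A i j \<le> 1"
  shows "serre A ds s x i j = s ((-1) ^ nat (1 - A i j)) (ad_pow A ds s x i j (nat (1 - A i j)))"
proof -
  interpret algebra_over s by fact
  interpret generic_param "qi ds i" by fact
  define N where "N = nat (1 - A i j)"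
  have N: "int N = 1 - A i j" using assms(3) by (simp add: N_def)
  have sgn: "(-1 :: qfield) ^ (N - k) = (-1) ^ N * (-1) ^ k" if "k \<le> N" for k
    using that by (auto simp: minus_one_power_iff)
  have "serre A ds s x i j = (\<Sum>k=0..N. s ((-1) ^ (N - k) * qbinom (qi ds i) (int N) (N - k))
      (x i ^ (N - k) * x j * x i ^ (N - (N - k))))"
    unfolding serre_def N[symmetric] nat_int by (subst sum.atLeastAtMost_rev) simp
  also have "\<dots> = (\<Sum>k=0..N. s ((-1) ^ N) (s ((-1) ^ k * qbinom (qi ds i) (int N) k)
      (x i ^ (N - k) * x j * x i ^ k)))"
    by (intro sum.cong refl) (simp add: sgn qbinom_symmetric mult.assoc)
  also have "\<dots> = s ((-1) ^ N) (ad_pow A ds s x i j N)"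
    by (simp add: ad_pow_def N scale_sum_right)
  finally show ?thesis by (simp add: N_def)
qed


section \<open>Eigenvectors of conjugation\<close>

locale conjugation = generic_param v + algebra_over s
  for v :: "'k::field" and s :: "'k \<Rightarrow> 'q::division_ring \<Rightarrow> 'q" +
  fixes g :: 'q
  assumes g_nonzero: "g \<noteq> 0"
begin

text \<open>The eigenspace of conjugation by \<open>g\<close> for the eigenvalue
  \<open>v powi m\<close>, written without inverses so that closure properties are direct
  computations.\<close>

definition eigen :: "int \<Rightarrow> 'q set" where
  "eigen m = {y. g * y = s (v powi m) (y * g)}"

lemma eigen_conj: "y \<in> eigen m \<longleftrightarrow> g * y * inverse g = s (v powi m) y"
proof
  assume "y \<in> eigen m"
  then show "g * y * inverse g = s (v powi m) y"
    using g_nonzero by (simp add: eigen_def scale_mult_left mult.assoc)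
next
  assume "g * y * inverse g = s (v powi m) y"
  then have "g * y * (inverse g * g) = s (v powi m) y * g"
    by (metis mult.assoc)
  then show "y \<in> eigen m"
    using g_nonzero by (simp add: eigen_def scale_mult_left)
qed

lemma eigen_0: "0 \<in> eigen m"
  by (simp add: eigen_def)

lemma eigen_add: "y \<in> eigen m \<Longrightarrow> z \<in> eigen m \<Longrightarrow> y + z \<in> eigen m"
  by (simp add: eigen_def distrib_left distrib_right scale_right_distrib)

lemma eigen_uminus: "y \<in> eigen m \<Longrightarrow> - y \<in> eigen m"
  by (simp add: eigen_def)

lemma eigen_scale: "y \<in> eigen m \<Longrightarrow> s c y \<in> eigen m"
  by (simp add: eigen_def scale_mult_left scale_mult_right mult.commute)

lemma eigen_mult:
  assumes "y \<in> eigen m" "z \<in> eigen n"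
  shows "y * z \<in> eigen (m + n)"
proof -
  have "g * (y * z) = s (v powi m) (y * (g * z))"
    using assms(1) by (simp add: eigen_def scale_mult_left flip: mult.assoc)
  with assms(2) v_nonzero show ?thesis
    by (simp add: eigen_def scale_mult_right mult.assoc power_int_add)
qed

lemma eigen_commute: "g * y = y * g \<Longrightarrow> y \<in> eigen 0"
  by (simp add: eigen_def)

text \<open>Multiplying by \<open>g\<close> on the left and subtracting \<open>v powi n\<close>
  times the right multiple removes the component at \<open>n\<close> and rescales the others by
  nonzero differences of powers of \<open>v\<close>.\<close>

lemma eigen_independent:
  assumes "finite S" "\<And>m. m \<in> S \<Longrightarrow> y m \<in> eigen m" "(\<Sum>m\<in>S. y m) = 0"
  shows "\<forall>m\<in>S. y m = 0"
  using assms
proof (induction S arbitrary: y)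
  case (insert n S)
  have "0 = g * (\<Sum>m\<in>insert n S. y m) - s (v powi n) ((\<Sum>m\<in>insert n S. y m) * g)"
    by (simp add: insert.prems)
  also have "\<dots> = (\<Sum>m\<in>insert n S. s (v powi m - v powi n) (y m)) * g"
    unfolding sum_distrib_left sum_distrib_right scale_sum_right sum_subtractf[symmetric]
    using insert.prems(1)
    by (intro sum.cong refl) (auto simp: eigen_def scale_mult_left scale_left_diff_distrib left_diff_distrib)
  finally have "(\<Sum>m\<in>S. s (v powi m - v powi n) (y m)) = 0"
    using g_nonzero insert.hyps by simp
  then have "\<forall>m\<in>S. s (v powi m - v powi n) (y m) = 0"
    using insert.prems by (intro insert.IH) (auto simp: eigen_scale)
  then have "\<forall>m\<in>S. y m = 0"
    using insert.hyps by (auto simp: powi_inj)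
  with insert show ?case by simp
qed simp

text \<open>A vector killed by a product of distinct linear factors of an operator splits into
  eigenvectors; here the operator is conjugation by \<open>g\<close>, and \<open>E\<close> records
  the successive factors. The induction decomposes the tail starting at \<open>E 1\<close>
  first.\<close>

lemma eigen_chain:
  assumes "\<And>k. k < n \<Longrightarrow> g * E k = (E (Suc k) + s (v powi \<mu> k) (E k)) * g"
    and "inj_on \<mu> {..<n}" and "E n = 0"
  shows "\<exists>y. (\<forall>r<n. y r \<in> eigen (\<mu> r)) \<and> E 0 = (\<Sum>r<n. y r)"
  using assms
proof (induction n arbitrary: E \<mu>)
  case (Suc n)
  have inj: "inj_on (\<lambda>k. \<mu> (Suc k)) {..<n}"
    using Suc.prems(2) by (fastforce simp: inj_on_def)
  obtain y where y: "\<forall>r<n. y r \<in> eigen (\<mu> (Suc r))" "E (Suc 0) = (\<Sum>r<n. y r)"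
    using Suc.IH[of "\<lambda>k. E (Suc k)" "\<lambda>k. \<mu> (Suc k)"] Suc.prems inj by auto
  \<comment> \<open>Dividing by eigenvalue differences lifts \<open>E 1\<close> through conjugation
    minus \<open>v powi \<mu> 0\<close>; the remainder \<open>e\<close> is then an eigenvector for
    \<open>\<mu> 0\<close>.\<close>
  define z where "z r = s (inverse (v powi \<mu> (Suc r) - v powi \<mu> 0)) (y r)" for r
  define e where "e = E 0 - (\<Sum>r<n. z r)"
  have z: "z r \<in> eigen (\<mu> (Suc r))" if "r < n" for r
    using y that by (simp add: z_def eigen_scale)
  have ne: "v powi \<mu> (Suc r) - v powi \<mu> 0 \<noteq> 0" if "r < n" for r
    using Suc.prems(2) that by (auto simp: powi_inj dest: inj_onD)
  have E1: "E (Suc 0) = (\<Sum>r<n. s (v powi \<mu> (Suc r) - v powi \<mu> 0) (z r))"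
    unfolding y(2) using ne by (intro sum.cong refl) (simp add: z_def)
  have "g * (\<Sum>r<n. z r) = (\<Sum>r<n. s (v powi \<mu> (Suc r)) (z r)) * g"
    unfolding sum_distrib_left sum_distrib_right using z
    by (intro sum.cong refl) (auto simp: eigen_def scale_mult_left)
  also have "(\<Sum>r<n. s (v powi \<mu> (Suc r)) (z r)) = E (Suc 0) + s (v powi \<mu> 0) (\<Sum>r<n. z r)"
    by (simp add: E1 scale_left_diff_distrib sum_subtractf scale_sum_right)
  finally have "e \<in> eigen (\<mu> 0)"
    using Suc.prems(1)[of 0]
    by (simp add: eigen_def e_def right_diff_distrib left_diff_distrib distrib_right scale_mult_left
        scale_right_diff_distrib)
  moreover have "E 0 = (\<Sum>r<Suc n. case r of 0 \<Rightarrow> e | Suc r \<Rightarrow> z r)"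
    by (simp add: sum.lessThan_Suc_shift e_def del: sum.lessThan_Suc)
  ultimately show ?case
    using z by (intro exI[of _ "\<lambda>r. case r of 0 \<Rightarrow> e | Suc r \<Rightarrow> z r"]) (auto split: nat.split)
qed simp

lemma conj_powi:
  assumes "y \<in> eigen m"
  shows "g powi n * y * g powi (- n) = s (v powi (n * m)) y"
proof -
  have y: "g * y = s (v powi m) (y * g)" using assms by (simp add: eigen_def)
  \<comment> \<open>The relation for \<open>inverse g\<close> is what the downward half of the
    integer induction needs.\<close>
  have "inverse g * (g * y) * inverse g = s (v powi m) (inverse g * y * (g * inverse g))"
    unfolding y by (simp add: scale_mult_left scale_mult_right mult.assoc)
  then have y': "inverse g * y = s (v powi (- m)) (y * inverse g)"
    using g_nonzero v_nonzero by (simp add: power_int_minus flip: mult.assoc)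
  have "g powi n * y = s (v powi (n * m)) (y * g powi n)"
  proof (induction n rule: int_induct[where k = 0])
    case (step1 n)
    have e: "g powi (n + 1) = g * g powi n"
      using power_int_add[of g 1 n] g_nonzero by (simp add: add.commute)
    have e': "v powi ((n + 1) * m) = v powi (n * m) * v powi m"
      using v_nonzero by (simp add: distrib_right power_int_add)
    have "g powi (n + 1) * y = s (v powi (n * m)) ((g * y) * g powi n)"
      unfolding e mult.assoc step1 by (simp add: scale_mult_right)
    then show ?case unfolding y e e' by (simp add: scale_mult_left mult.assoc)
  next
    case (step2 n)
    have e: "g powi (n - 1) = inverse g * g powi n"
      using power_int_add[of g "-1" n] g_nonzero by (simp add: power_int_minus)
    have e': "v powi ((n - 1) * m) = v powi (n * m) * v powi (- m)"
      using v_nonzero by (simp add: left_diff_distrib flip: power_int_add)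
    have "g powi (n - 1) * y = s (v powi (n * m)) ((inverse g * y) * g powi n)"
      unfolding e mult.assoc step2 by (simp add: scale_mult_right)
    then show ?case unfolding y' e e' by (simp add: scale_mult_left mult.assoc)
  qed simp
  then show ?thesis
    using g_nonzero by (simp add: scale_mult_left mult.assoc flip: power_int_add)
qed

end


section \<open>Extension to fractions\<close>

text \<open>\<open>G\<close> is the graph of an isomorphism between two subrings, each of which has
  the whole skew field as its fractions; \<open>zero\<close> makes it single-valued and injective.
  The extension sends a b^-1 to a' b'^-1, and the Ore condition comes out of
  \<open>dom\<close>.\<close>

lemma additive_relation_extends_to_fractions:
  fixes G :: "'q::division_ring \<Rightarrow> 'q \<Rightarrow> bool"
  assumes one: "G 1 1"
    and add: "\<And>x x' y y'. G x x' \<Longrightarrow> G y y' \<Longrightarrow> G (x + y) (x' + y')"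
    and mult: "\<And>x x' y y'. G x x' \<Longrightarrow> G y y' \<Longrightarrow> G (x * y) (x' * y')"
    and minus: "\<And>x x'. G x x' \<Longrightarrow> G (- x) (- x')"
    and zero: "\<And>x x'. G x x' \<Longrightarrow> x = 0 \<longleftrightarrow> x' = 0"
    and dom: "\<And>z. \<exists>a b a' b'. G a a' \<and> G b b' \<and> b \<noteq> 0 \<and> z = a * inverse b"
    and ran: "\<And>z. \<exists>a b a' b'. G a a' \<and> G b b' \<and> b' \<noteq> 0 \<and> z = a' * inverse b'"
  shows "\<exists>h. bij h \<and> (\<forall>x y. h (x + y) = h x + h y) \<and> (\<forall>x y. h (x * y) = h x * h y) \<and>
    (\<forall>x x'. G x x' \<longrightarrow> h x = x')"
proof -
  define H where "H z w \<longleftrightarrow> (\<exists>a a' b b'. G a a' \<and> G b b' \<and> b \<noteq> 0 \<and> b' \<noteq> 0 \<and>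
    z = a * inverse b \<and> w = a' * inverse b')" for z w
  have HI: "H (a * inverse b) (a' * inverse b')" if "G a a'" "G b b'" "b \<noteq> 0" for a a' b b'
    unfolding H_def using that zero by blast
  have zero': "a' = b'" if "G a a'" "G b b'" "a = b" for a a' b b'
  proof -
    have "G (a + - b) (a' + - b')" using that by (intro add minus)
    then show ?thesis using zero[of "a + - b" "a' + - b'"] that by simp
  qed
  \<comment> \<open>By \<open>dom\<close>, \<open>inverse b * a\<close> is itself a right fraction,
    which is the Ore condition; \<open>zero'\<close> transfers the resulting equation to the
    images.\<close>
  have ore: "\<exists>c c' d d'. G c c' \<and> G d d' \<and> d \<noteq> 0 \<and> b * c = a * d \<and> b' * c' = a' * d'"
    if b: "G b b'" "b \<noteq> 0" and a: "G a a'" for a a' b b'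
  proof -
    obtain c d c' d' where c: "G c c'" "G d d'" "d \<noteq> 0" "inverse b * a = c * inverse d"
      using dom by blast
    have "b * c = b * (c * inverse d) * d" using c(3) by (simp add: mult.assoc)
    also have "\<dots> = a * d" using b(2) by (simp add: mult.assoc[symmetric] flip: c(4))
    finally have e: "b * c = a * d" .
    have "b' * c' = a' * d'"
      by (rule zero'[OF _ _ e]) (intro mult a b c)+
    with e c show ?thesis by blast
  qed
  have H_add: "H (z + w) (z' + w')" if z: "H z z'" and w: "H w w'" for z z' w w'
  proof -
    obtain a a' b b' where 1: "G a a'" "G b b'" "b \<noteq> 0" "b' \<noteq> 0" "z = a * inverse b" "z' = a' * inverse b'"
      using z by (auto simp: H_def)
    obtain p p' r r' where 2: "G p p'" "G r r'" "r \<noteq> 0" "r' \<noteq> 0" "w = p * inverse r" "w' = p' * inverse r'"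
      using w by (auto simp: H_def)
    \<comment> \<open>The Ore condition applied to the denominators \<open>b\<close> and
      \<open>r\<close> gives a common right denominator.\<close>
    obtain c c' d d' where 3: "G c c'" "G d d'" "d \<noteq> 0" "b * c = r * d" "b' * c' = r' * d'"
      using ore[OF 1(2,3) 2(2)] by blast
    have d': "d' \<noteq> 0" using 3 zero by blast
    have c: "c \<noteq> 0" "c' \<noteq> 0" using 3 2 d' by (metis mult_eq_0_iff)+
    have frac: "x * inverse y + u * inverse v = (x * k + u * l) * inverse (y * k)"
      if "y * k = v * l" "k \<noteq> 0" "l \<noteq> 0" for x y u v k l :: 'q
    proof -
      have "x * k * inverse (y * k) = x * inverse y" if "k \<noteq> 0" for x y k :: 'q
      proof (cases "y = 0")
        case False
        then have "x * k * inverse (y * k) = x * (k * inverse k) * inverse y"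
          by (simp only: nonzero_inverse_mult_distrib[OF False that] mult.assoc)
        then show ?thesis using that by simp
      qed simp
      then show ?thesis using that by (metis distrib_right)
    qed
    have "H ((a * c + p * d) * inverse (b * c)) ((a' * c' + p' * d') * inverse (b' * c'))"
      using 1 c by (intro HI add mult 1 2 3) simp
    then show ?thesis
      using frac[of b c r d a p] frac[of b' c' r' d' a' p'] 1 2 3 c d' by simp
  qed
  have H_mult: "H (z * w) (z' * w')" if z: "H z z'" and w: "H w w'" for z z' w w'
  proof -
    obtain a a' b b' where 1: "G a a'" "G b b'" "b \<noteq> 0" "b' \<noteq> 0" "z = a * inverse b" "z' = a' * inverse b'"
      using z by (auto simp: H_def)
    obtain p p' r r' where 2: "G p p'" "G r r'" "r \<noteq> 0" "r' \<noteq> 0" "w = p * inverse r" "w' = p' * inverse r'"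
      using w by (auto simp: H_def)
    \<comment> \<open>Here the Ore condition moves the inner denominator \<open>b\<close> past the
      numerator \<open>p\<close>.\<close>
    obtain c c' d d' where 3: "G c c'" "G d d'" "d \<noteq> 0" "b * c = p * d" "b' * c' = p' * d'"
      using ore[OF 1(2,3) 2(1)] by blast
    have d': "d' \<noteq> 0" using 3 zero by blast
    have frac: "x * inverse y * (u * inverse v) = (x * k) * inverse (v * l)"
      if "y * k = u * l" "y \<noteq> 0" "v \<noteq> 0" "l \<noteq> 0" for x y u v k l :: 'q
    proof -
      have "k = inverse y * u * l"
        using that by (metis left_inverse mult.assoc mult_1)
      then have "x * k * inverse (v * l) = x * inverse y * u * (l * inverse l) * inverse v"
        using that by (simp only: nonzero_inverse_mult_distrib mult.assoc not_False_eq_True)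
      then show ?thesis using that(4) by (auto simp: mult.assoc)
    qed
    have "H ((a * c) * inverse (r * d)) ((a' * c') * inverse (r' * d'))"
      using 2 3 by (intro HI mult 1 2 3) simp
    then show ?thesis
      using frac[of b c p d r a] frac[of b' c' p' d' r' a'] 1 2 3 d' by simp
  qed
  have H_minus: "H (- z) (- z')" if "H z z'" for z z'
    using that minus unfolding H_def by (metis mult_minus_left)
  have H_zero: "z = 0 \<longleftrightarrow> z' = 0" if "H z z'" for z z'
    using that zero unfolding H_def by (metis inverse_nonzero_iff_nonzero mult_eq_0_iff)
  \<comment> \<open>Applying \<open>H_zero\<close> to the difference yields single-valuedness and
    injectivity of \<open>H\<close> at once.\<close>
  have H_cancel: "z = w \<longleftrightarrow> z' = w'" if "H z z'" "H w w'" for z z' w w'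
    using H_zero[OF H_add[OF that(1) H_minus[OF that(2)]]] by (metis eq_iff_diff_eq_0 diff_conv_add_uminus)
  have "\<exists>w. H z w" for z
    using dom[of z] HI by metis
  then obtain h where h: "\<And>z. H z (h z)" by metis
  have h_eq: "h z = w" if "H z w" for z w
    using H_cancel[OF h[of z] that] by simp
  have "bij h"
  proof (rule bijI)
    show "inj h" using H_cancel[OF h h] by (auto intro: injI)
    show "surj h"
    proof (rule surjI)
      fix w
      obtain a b a' b' where "G a a'" "G b b'" "b' \<noteq> 0" "w = a' * inverse b'"
        using ran by blast
      then have "H (a * inverse b) w" using HI zero by blast
      then show "h (SOME z. H z w) = w" by (metis h_eq someI)
    qed
  qed
  moreover have "G x x' \<Longrightarrow> h x = x'" for x x'
    using HI[OF _ one, of x x'] h_eq by simp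
  ultimately show ?thesis
    using h_eq[OF H_add[OF h h]] h_eq[OF H_mult[OF h h]] by blast
qed


section \<open>Twisting eigenvectors by central elements\<close>

locale twist = conjugation v s g
  for v :: "'k::field" and s :: "'k \<Rightarrow> 'q::division_ring \<Rightarrow> 'q" and g :: 'q +
  fixes P :: "int \<Rightarrow> 'q"
  assumes P_central: "P m * z = z * P m"
    and P_0: "P 0 = 1" and P_add: "P (m + n) = P m * P n"
begin

text \<open>
  The graph of the twist \<open>y \<mapsto> P m * y\<close> on sums of eigenvectors. A relation avoids choosing a
  decomposition; that it is single-valued follows from the independence of the eigenspaces.
\<close>

inductive twisted :: "'q \<Rightarrow> 'q \<Rightarrow> bool" where
  eigen: "y \<in> eigen m \<Longrightarrow> twisted y (P m * y)"
| add: "twisted x x' \<Longrightarrow> twisted y y' \<Longrightarrow> twisted (x + y) (x' + y')"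

lemma P_nonzero: "P m \<noteq> 0"
  using P_add[of m "- m"] P_0 by auto

lemma P_mult_eigen: "y \<in> eigen m \<Longrightarrow> P n * y \<in> eigen m"
  using eigen_mult[of "P n" 0 y m] eigen_commute[of "P n"] P_central[of n g] by simp

lemma twisted_commuting: "g * y = y * g \<Longrightarrow> twisted y y"
  using twisted.eigen[OF eigen_commute] by (simp add: P_0)

text \<open>On eigenvectors the weights add, and the central factors \<open>P m\<close> and
  \<open>P n\<close> combine to \<open>P (m + n)\<close>; distributivity does the rest.\<close>

lemma twisted_mult:
  assumes "twisted x x'" "twisted y y'"
  shows "twisted (x * y) (x' * y')"
  using assms(1)
proof induction
  case (eigen x m)
  show ?case using assms(2)
  proof induction
    case (eigen y n)
    have "P m * x * (P n * y) = P m * P n * (x * y)"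
      using P_central[of n x] by (metis mult.assoc)
    then show ?case
      using twisted.eigen[OF eigen_mult[OF \<open>x \<in> eigen m\<close> eigen]] by (simp add: P_add)
  qed (simp add: distrib_left twisted.add)
qed (simp add: distrib_right twisted.add)

lemma twisted_minus: "twisted x x' \<Longrightarrow> twisted (- x) (- x')"
proof (induction rule: twisted.induct)
  case (eigen y m)
  then show ?case using twisted.eigen[OF eigen_uminus] by fastforce
next
  case (add x x' y y')
  then show ?case using twisted.add[of "- x" "- x'" "- y" "- y'"] by (simp add: add.commute)
qed

lemma twisted_sum:
  "(\<And>r. r \<in> S \<Longrightarrow> twisted (x r) (x' r)) \<Longrightarrow> twisted (sum x S) (sum x' S)"
proof (induction S rule: infinite_finite_induct)
  case (insert r S)
  then show ?case by (simp add: twisted.add)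
qed (simp_all add: twisted_commuting)

text \<open>Collecting summands by weight brings \<open>twisted\<close> into the form to which
  independence of eigenspaces applies.\<close>

lemma twisted_decomposition:
  assumes "twisted x x'"
  shows "\<exists>S y. finite S \<and> (\<forall>m. y m \<in> eigen m) \<and> x = (\<Sum>m\<in>S. y m) \<and> x' = (\<Sum>m\<in>S. P m * y m)"
  using assms
proof induction
  case (eigen y m)
  then show ?case
    by (intro exI[of _ "{m}"] exI[of _ "\<lambda>n. if n = m then y else 0"]) (auto simp: eigen_0)
next
  case (add x x' z z')
  then obtain S y T w where
    1: "finite S" "\<forall>m. y m \<in> eigen m" "x = (\<Sum>m\<in>S. y m)" "x' = (\<Sum>m\<in>S. P m * y m)" and
    2: "finite T" "\<forall>m. w m \<in> eigen m" "z = (\<Sum>m\<in>T. w m)" "z' = (\<Sum>m\<in>T. P m * w m)"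
    by blast
  \<comment> \<open>Extending by zero to the union allows the two sums to be added weight by
    weight.\<close>
  have ext: "(\<Sum>m\<in>S'. F m) = (\<Sum>m\<in>S \<union> T. if m \<in> S' then F m else 0)"
    if "S' \<subseteq> S \<union> T" for F :: "int \<Rightarrow> 'q" and S'
    using that 1(1) 2(1) by (simp add: sum.If_cases Int_absorb1)
  define u where "u m = (if m \<in> S then y m else 0) + (if m \<in> T then w m else 0)" for m
  have Pu: "P m * u m = (if m \<in> S then P m * y m else 0) + (if m \<in> T then P m * w m else 0)" for m
    by (simp add: u_def distrib_left)
  have "\<forall>m. u m \<in> eigen m"
    using 1 2 by (auto simp: u_def intro!: eigen_add eigen_0)
  moreover have "x + z = (\<Sum>m\<in>S \<union> T. u m)"
    using ext[of S y] ext[of T w] by (simp add: 1 2 u_def sum.distrib)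
  moreover have "x' + z' = (\<Sum>m\<in>S \<union> T. P m * u m)"
    using ext[of S "\<lambda>m. P m * y m"] ext[of T "\<lambda>m. P m * w m"] by (simp add: 1 2 Pu sum.distrib)
  ultimately show ?case using 1 2 by (intro exI[of _ "S \<union> T"] exI[of _ u]) auto
qed

text \<open>Independence turns either side into the vanishing of all components, and each
  \<open>P m\<close> is nonzero.\<close>

lemma twisted_eq_0_iff:
  assumes "twisted x x'"
  shows "x = 0 \<longleftrightarrow> x' = 0"
proof -
  obtain S y where y: "finite S" "\<And>m. y m \<in> eigen m" "x = (\<Sum>m\<in>S. y m)" "x' = (\<Sum>m\<in>S. P m * y m)"
    using twisted_decomposition[OF assms] by blast
  have "x = 0 \<longleftrightarrow> (\<forall>m\<in>S. y m = 0)"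
    using eigen_independent[of S y] y by auto
  moreover have "x' = 0 \<longleftrightarrow> (\<forall>m\<in>S. P m * y m = 0)"
    using eigen_independent[of S "\<lambda>m. P m * y m"] y P_mult_eigen by (metis (no_types, lifting) sum.neutral)
  ultimately show ?thesis by (simp add: P_nonzero)
qed

text \<open>The inverse twist multiplies weight \<open>m\<close> by \<open>P (- m)\<close>. Hence
  fractions over the domain are also fractions over the range.\<close>

lemma twisted_range: "twisted x x' \<Longrightarrow> \<exists>z. twisted z x"
proof (induction rule: twisted.induct)
  case (eigen y m)
  have "P m * (P (- m) * y) = y"
    using P_add[of m "- m"] P_0 by (simp flip: mult.assoc)
  then show ?case using twisted.eigen[OF P_mult_eigen[OF eigen, of "- m"]] by auto
qed (auto intro: twisted.add)

lemma twisted_extends: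
  assumes "\<And>z. \<exists>a b a' b'. twisted a a' \<and> twisted b b' \<and> b \<noteq> 0 \<and> z = a * inverse b"
  shows "\<exists>h. algebra_automorphism s h \<and> (\<forall>x x'. twisted x x' \<longrightarrow> h x = x')"
proof -
  have ran: "\<exists>a b a' b'. twisted a a' \<and> twisted b b' \<and> b' \<noteq> 0 \<and> z = a' * inverse b'" for z
    using assms[of z] twisted_range by metis
  obtain h where h: "bij h" "\<And>x y. h (x + y) = h x + h y" "\<And>x y. h (x * y) = h x * h y"
      "\<And>x x'. twisted x x' \<Longrightarrow> h x = x'"
    using additive_relation_extends_to_fractions[of twisted, OF twisted_commuting twisted.add twisted_mult
        twisted_minus twisted_eq_0_iff assms ran] by auto
  \<comment> \<open>Scalars commute with \<open>g\<close> and are fixed, so linearity of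
    \<open>h\<close> follows from multiplicativity.\<close>
  have scal: "h (s c 1) = s c 1" for c
    by (intro h twisted_commuting) (simp add: scale_mult_left scale_mult_right)
  have "h (s c x) = s c (h x)" for c x
    using h(3)[of "s c 1" x] by (simp add: scal scale_mult_left)
  moreover have "h 1 = 1" by (intro h twisted_commuting) simp
  ultimately have "algebra_hom s s h"
    by (intro algebra_homI) (simp_all add: h algebra_over_axioms)
  with h show ?thesis by (auto simp: algebra_automorphism_def)
qed

end


section \<open>The eigenvector expansion of the generators\<close>

text \<open>The Serre relation ends the chain of q-commutators, so \<open>eigen_chain\<close>
  applies. On each component the steps of the chain multiply by eigenvalue differences, which
  accounts for the products.\<close>

lemma serre_eigenvectors:
  fixes s :: "qfield \<Rightarrow> 'q::division_ring \<Rightarrow> 'q"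
  assumes "conjugation (qi ds i) s (x i)" and "serre A ds s x i j = 0" and "A i j \<le> 0"
  obtains y where
    "\<And>r. r \<le> nat (- A i j) \<Longrightarrow> y r \<in> conjugation.eigen (qi ds i) s (x i) (A i j + 2 * int r)"
    and "\<And>k. ad_pow A ds s x i j k * x i powi (- int k) = (\<Sum>r\<le>nat (- A i j).
      s (\<Prod>\<nu><k. qi ds i powi (A i j + 2 * int r) - qi ds i powi (A i j + 2 * int \<nu>)) (y r))"
    and "x j = (\<Sum>r\<le>nat (- A i j). y r)"
proof -
  define v where "v = qi ds i"
  define g where "g = x i"
  interpret conjugation v s g using assms(1) by (simp add: v_def g_def)
  define a where "a = A i j"
  define M where "M = nat (- a)"
  define E where "E k = ad_pow A ds s x i j k * g powi (- int k)" for k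
  have ad_Suc: "ad_pow A ds s x i j (Suc k) = g * ad_pow A ds s x i j k - s (v powi (a + 2 * int k)) (ad_pow A ds s x i j k * g)" for k
    using ad_pow_Suc[of s ds i A x j k] algebra_over_axioms generic_param_axioms by (simp add: v_def g_def a_def)
  have E_Suc: "E (Suc k) = g * E k * inverse g - s (v powi (a + 2 * int k)) (E k)" for k
  proof -
    have e: "- int (Suc k) = - int k + - 1" "- int (Suc k) = - 1 + - int k" by simp_all
    have "g powi (- int (Suc k)) = g powi (- int k) * inverse g"
      unfolding e(1) by (subst power_int_add) (simp_all add: g_nonzero power_int_minus)
    then have 1: "g * ad_pow A ds s x i j k * g powi (- int (Suc k)) = g * E k * inverse g"
      by (simp add: E_def mult.assoc)
    have 2: "g powi (- int (Suc k)) = inverse g * g powi (- int k)"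
      unfolding e(2) by (subst power_int_add) (simp_all add: g_nonzero power_int_minus)
    have "ad_pow A ds s x i j k * g * g powi (- int (Suc k)) = ad_pow A ds s x i j k * (g * inverse g) * g powi (- int k)"
      unfolding 2 by (simp only: mult.assoc)
    then have "ad_pow A ds s x i j k * g * g powi (- int (Suc k)) = E k"
      using g_nonzero by (simp add: E_def)
    with 1 show ?thesis
      unfolding E_def[of "Suc k"] ad_Suc by (simp add: left_diff_distrib scale_mult_left)
  qed
  have E_chain: "g * E k = (E (Suc k) + s (v powi (a + 2 * int k)) (E k)) * g" for k
    unfolding E_Suc using g_nonzero by (simp add: mult.assoc)
  have E_0: "E 0 = x j"
    using generic_param.qbinom_0[OF generic_param_axioms] by (simp add: E_def ad_pow_def v_def)
  have N: "nat (1 - A i j) = Suc M"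
    using assms(3) by (simp add: M_def a_def)
  \<comment> \<open>The chain stops at 1 - a_ij = \<open>Suc M\<close>, so the eigenvectors are
    indexed by \<open>r \<le> M\<close>.\<close>
  have "ad_pow A ds s x i j (Suc M) = 0"
    using serre_eq_ad_pow[of s ds i A j x] algebra_over_axioms generic_param_axioms assms(2,3)
    by (simp add: v_def N)
  then have "E (Suc M) = 0" by (simp add: E_def)
  then obtain y where y: "\<And>r. r < Suc M \<Longrightarrow> y r \<in> eigen (a + 2 * int r)" "E 0 = (\<Sum>r<Suc M. y r)"
    using eigen_chain[of "Suc M" E "\<lambda>k. a + 2 * int k"] E_chain by (force simp: inj_on_def)
  have E_y: "E k = (\<Sum>r\<le>M. s (\<Prod>\<nu><k. v powi (a + 2 * int r) - v powi (a + 2 * int \<nu>)) (y r))" for k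
  proof (induction k)
    case 0
    then show ?case by (simp add: y(2) lessThan_Suc_atMost)
  next
    case (Suc k)
    show ?case
      unfolding E_Suc Suc sum_distrib_left sum_distrib_right scale_sum_right sum_subtractf[symmetric]
    proof (intro sum.cong refl)
      fix r assume "r \<in> {..M}"
      then have "g * y r * inverse g = s (v powi (a + 2 * int r)) (y r)"
        using y(1) by (simp add: eigen_conj flip: less_Suc_eq_le)
      then show "g * s (\<Prod>\<nu><k. v powi (a + 2 * int r) - v powi (a + 2 * int \<nu>)) (y r) * inverse g
          - s (v powi (a + 2 * int k)) (s (\<Prod>\<nu><k. v powi (a + 2 * int r) - v powi (a + 2 * int \<nu>)) (y r))
        = s (\<Prod>\<nu><Suc k. v powi (a + 2 * int r) - v powi (a + 2 * int \<nu>)) (y r)"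
        by (simp add: scale_mult_left scale_mult_right mult.commute left_diff_distrib scale_left_diff_distrib)
    qed
  qed
  show ?thesis
    by (rule that[of y])
      (use y E_y E_0 in \<open>auto simp: v_def g_def a_def M_def E_def lessThan_Suc_atMost less_Suc_eq_le\<close>)
qed

text \<open>Exchanging the sums puts the interpolation identity in front of each \<open>y r\<close>.
  The homomorphism \<open>\<phi>\<close> covers both uses: scalars for integer exponents, torus
  elements for lattice exponents.\<close>

lemma weighted_sum_eigenvectors:
  fixes s :: "'k::field \<Rightarrow> 'q::ring_1 \<Rightarrow> 'q" and sR :: "'k \<Rightarrow> 'r::comm_ring_1 \<Rightarrow> 'r"
  assumes "generic_param v" and \<phi>: "algebra_hom sR s \<phi>"
    and P: "P 0 = 1" "\<And>m n. P (m + n) = P m * P n"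
    and E: "\<And>k. E k = (\<Sum>r\<le>M. s (\<Prod>\<nu><k. v powi (a + 2 * int r) - v powi (a + 2 * int \<nu>)) (y r))"
  shows "(\<Sum>k\<le>M. \<phi> (weight_coeff sR v P a k) * E k) = (\<Sum>r\<le>M. \<phi> (P (a + 2 * int r)) * y r)"
proof -
  interpret algebra_over s using \<phi> by (simp add: algebra_hom_def)
  define e where "e k r = (\<Prod>\<nu><k. v powi (a + 2 * int r) - v powi (a + 2 * int \<nu>))" for k r
  have "(\<Sum>k\<le>M. \<phi> (weight_coeff sR v P a k) * E k)
    = (\<Sum>k\<le>M. \<Sum>r\<le>M. \<phi> (sR (e k r) (weight_coeff sR v P a k)) * y r)"
    unfolding E e_def[symmetric] sum_distrib_left
    by (simp add: algebra_hom_simps[OF \<phi>] scale_mult_left scale_mult_right)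
  also have "\<dots> = (\<Sum>r\<le>M. \<phi> (\<Sum>k\<le>M. sR (e k r) (weight_coeff sR v P a k)) * y r)"
    unfolding algebra_hom_simps[OF \<phi>] sum_distrib_right by (rule sum.swap)
  also have "\<dots> = (\<Sum>r\<le>M. \<phi> (P (a + 2 * int r)) * y r)"
    unfolding e_def using \<phi> assms(1) P
    by (intro sum.cong refl arg_cong2[of _ _ _ _ "(*)"] arg_cong[of _ _ \<phi>] weight_coeff_sum)
      (auto simp: algebra_hom_def)
  finally show ?thesis .
qed

section \<open>Weight coefficients for integer and for lattice exponents\<close>

lemma weight_coeff_powi:
  assumes "v \<noteq> 0"
  shows "weight_coeff (*) v (\<lambda>m. v powi (n * m)) a k
    = v powi ((int k + a) * (n - int k)) * qbinom v n k"
proof -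
  have "v powi (- ((int k + a) * int k)) * v powi (n * (int k + a)) = v powi ((int k + a) * (n - int k))"
    using assms by (simp add: algebra_simps flip: power_int_add)
  moreover have "inverse (v - inverse v) * (v powi (- int \<nu>) * v powi n - v powi int \<nu> * v powi (- n))
    = qint v (n - int \<nu>)" for \<nu>
    using assms by (simp add: qint_def divide_inverse mult.commute power_int_diff power_int_minus)
  ultimately show ?thesis
    by (simp add: weight_coeff_def qbinom_def divide_inverse mult_ac)
qed

lemma weight_coeff_qi_wt:
  "weight_coeff (pm_scale (*)) (qi ds i) (qi_wt ds i lam) a k
    = qi_wt_shift ds i (int k + a) lam (int k) * qbinom_wt ds i lam k"
  by (simp add: weight_coeff_def qi_wt_shift_def qbinom_wt_def qint_wt_def)

lemma qi_wt_0: "qi_wt ds i lam 0 = 1"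
  by (simp add: qi_wt_def torus_def)

lemma qi_wt_add: "qi_wt ds i lam (m + n) = qi_wt ds i lam m * qi_wt ds i lam n"
  by (simp add: qi_wt_def torus_def mult_single distrib_right zmodule.scale_left_distrib)

section \<open>Genericity of q_i\<close>

lemma qroot_generic: "generic_param qroot"
proof
  have pow: "qroot ^ n = Fract ([:0, 1:] ^ n) 1" for n
    by (induction n) (simp_all add: qroot_def One_fract_def)
  have nat: "n = 0" if "qroot ^ n = 1" for n
  proof -
    \<comment> \<open>The equation descends to polynomials, where degrees decide.\<close>
    have "([:0, 1:] :: rat poly) ^ n = 1"
      using that by (simp add: pow One_fract_def eq_fract)
    then have "degree (([:0, 1:] :: rat poly) ^ n) = 0" by simp
    then show ?thesis by (simp add: degree_linear_power)
  qed
  show "qroot \<noteq> 0"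
    by (simp add: qroot_def Zero_fract_def eq_fract)
  show "m = 0" if "qroot powi m = 1" for m
    using that nat[of "nat m"] nat[of "nat (- m)"]
    by (auto simp: power_int_def field_simps split: if_splits)
qed

lemma generic_param_powi:
  assumes "generic_param v" "m \<noteq> 0"
  shows "generic_param (v powi m)"
proof
  interpret generic_param v by fact
  show "v powi m \<noteq> 0" by (simp add: v_nonzero)
  show "n = 0" if "(v powi m) powi n = 1" for n
    using that v_generic[of "m * n"] assms(2) by (simp add: power_int_mult)
qed

text \<open>Multiplying up the denominators of finitely many rationals shows that the minimum in
  \<open>common_denom\<close> is attained.\<close>

lemma common_denom_exists:
  fixes ds :: "'i::finite \<Rightarrow> rat"
  shows "\<exists>n>0. \<forall>i. of_nat n * ds i \<in> \<int>"
proof -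
  have "\<exists>n>0. \<forall>i\<in>S. of_nat n * ds i \<in> \<int>" if "finite S" for S
    using that
  proof induction
    case (insert i S)
    then obtain n where n: "n > 0" "\<forall>i\<in>S. of_nat n * ds i \<in> \<int>" by auto
    obtain p q where q: "quotient_of (ds i) = (p, q)" by force
    then have q0: "q > 0" by (rule quotient_of_denom_pos)
    have "of_int q * ds i \<in> \<int>"
      using quotient_of_div[OF q] q0 by simp
    then have "of_nat (nat q) * ds i \<in> \<int>" using q0 by simp
    then have "of_nat (nat q * n) * ds k \<in> \<int>" if "k \<in> insert i S" for k
      using that n Ints_mult[of "of_nat n" "of_nat (nat q) * ds i"] Ints_mult[of "of_nat (nat q)" "of_nat n * ds k"]
      by (auto simp: mult_ac)
    with n q0 show ?case by (intro exI[of _ "nat q * n"]) auto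
  qed auto
  from this[of UNIV] show ?thesis by simp
qed

lemma qi_generic:
  fixes ds :: "'i::finite \<Rightarrow> rat"
  assumes "0 < ds i"
  shows "generic_param (qi ds i)"
proof -
  have cd: "0 < common_denom ds \<and> (\<forall>i. of_nat (common_denom ds) * ds i \<in> \<int>)"
    unfolding common_denom_def using common_denom_exists[of ds] by (rule LeastI_ex)
  then obtain z where z: "of_nat (common_denom ds) * ds i = of_int z" by (auto elim: Ints_cases)
  \<comment> \<open>This number is a positive integer, so the floor in \<open>dnum\<close> is exact
    and the exponent of \<open>qroot\<close> is nonzero.\<close>
  have "0 < of_nat (common_denom ds) * ds i" using cd assms by simp
  then have "dnum ds i \<noteq> 0" by (simp add: dnum_def z)
  then show ?thesis unfolding qi_def by (intro generic_param_powi qroot_generic)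
qed

text \<open>Conjugation by the n-th power scales weight m by q_i^(n m). The interpolation identity,
  read backwards, returns from eigenvectors to the \<open>ad_pow\<close> terms.\<close>

lemma powi_conj_serre:
  fixes s :: "qfield \<Rightarrow> 'q::division_ring \<Rightarrow> 'q"
  assumes "conjugation (qi ds i) s (x i)" and "serre A ds s x i j = 0" and "A i j \<le> 0"
  shows "x i powi n * x j * x i powi (- n) = (\<Sum>k=0..nat (- A i j).
    s (qi ds i powi ((int k + A i j) * (n - int k)) * qbinom (qi ds i) n k)
      (ad_pow A ds s x i j k * x i powi (- int k)))"
proof -
  interpret conjugation "qi ds i" s "x i" by fact
  define E where "E k = ad_pow A ds s x i j k * x i powi (- int k)" for k
  define P where "P m = qi ds i powi (n * m)" for m
  obtain y where y: "\<And>r. r \<le> nat (- A i j) \<Longrightarrow> y r \<in> eigen (A i j + 2 * int r)"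
    and E: "\<And>k. E k = (\<Sum>r\<le>nat (- A i j).
      s (\<Prod>\<nu><k. qi ds i powi (A i j + 2 * int r) - qi ds i powi (A i j + 2 * int \<nu>)) (y r))"
    and xj: "x j = (\<Sum>r\<le>nat (- A i j). y r)"
    unfolding E_def using serre_eigenvectors[OF assms] by blast
  have hom: "algebra_hom (*) s (\<lambda>c. s c 1)"
    by (intro algebra_homI)
      (simp_all add: algebra_over_field algebra_over_axioms scale_left_distrib scale_mult_left)
  have "x i powi n * x j * x i powi (- n) = (\<Sum>r\<le>nat (- A i j). s (P (A i j + 2 * int r)) 1 * y r)"
    unfolding xj sum_distrib_left sum_distrib_right
    using y by (intro sum.cong refl) (simp add: conj_powi P_def scale_mult_left)
  also have "\<dots> = (\<Sum>k\<le>nat (- A i j). s (weight_coeff (*) (qi ds i) P (A i j) k) 1 * E k)"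
    by (rule weighted_sum_eigenvectors[OF generic_param_axioms hom _ _ E, symmetric])
      (simp_all add: P_def v_nonzero distrib_left power_int_add)
  finally show ?thesis
    unfolding P_def E_def weight_coeff_powi[OF v_nonzero]
    by (simp add: scale_mult_left atMost_atLeast0)
qed

section \<open>Compatibility of homomorphisms with inverses and evaluation\<close>

lemma algebra_hom_inverse:
  fixes s :: "'k::field \<Rightarrow> 'q::division_ring \<Rightarrow> 'q" and s' :: "'k \<Rightarrow> 'p::division_ring \<Rightarrow> 'p"
  assumes h: "algebra_hom s s' h"
  shows "h (inverse z) = inverse (h z)"
proof (cases "z = 0")
  case False
  then have "h z * h (inverse z) = 1"
    by (simp add: algebra_hom_simps(4)[OF h] flip: algebra_hom_simps(5)[OF h])
  then show ?thesis by (rule inverse_unique[symmetric])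
qed (simp add: algebra_hom_simps[OF h])

lemma commutes_inverse:
  fixes b c :: "'q::division_ring"
  assumes "c * b = b * c"
  shows "c * inverse b = inverse b * c"
proof (cases "b = 0")
  case False
  have "inverse b * (c * b) * inverse b = inverse b * c"
    by (simp only: mult.assoc right_inverse[OF False] mult_1_right)
  moreover have "inverse b * (b * c) * inverse b = c * inverse b"
    by (simp only: left_inverse[OF False] mult_1_left mult.assoc[symmetric])
  ultimately show ?thesis using assms by simp
qed simp

lemma free_eval_hom:
  assumes "algebra_hom s s' h"
  shows "h (free_eval s x p) = free_eval s' (\<lambda>j. h (x j)) p"
proof -
  interpret a: algebra_over s using assms by (simp add: algebra_hom_def)
  interpret b: algebra_over s' using assms by (simp add: algebra_hom_def)
  have "h (prod_list (map x l)) = prod_list (map (\<lambda>j. h (x j)) l)" for l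
    by (induction l) (simp_all add: algebra_hom_simps[OF assms])
  then show ?thesis
    by (induction p rule: pm_induct)
      (simp_all add: a.free_eval_single b.free_eval_single a.free_eval_add b.free_eval_add
        algebra_hom_simps[OF assms])
qed


section \<open>The automorphism\<close>

locale torus_extension = algebra_over scaleA
  for scaleA :: "qfield \<Rightarrow> 'a::ring_1 \<Rightarrow> 'a" +
  fixes scaleQ :: "qfield \<Rightarrow> 'q::division_ring \<Rightarrow> 'q"
    and \<kappa> :: "('y::ab_group_add \<Rightarrow>\<^sub>0 'a) \<Rightarrow> 'q"
    and f :: "'i \<Rightarrow> 'a"
  assumes fractions: "skew_field_of_fractions (pm_scale scaleA) scaleQ \<kappa>"
    and f_generate: "surj (free_eval scaleA f)"
begin

definition torus_map :: "'y Uq_zero \<Rightarrow> 'q" where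
  "torus_map u = \<kappa> (tens scaleA 1 u)"

definition base_map :: "'a \<Rightarrow> 'q" where
  "base_map a = \<kappa> (tens scaleA a 1)"

lemma hom_\<kappa>: "algebra_hom (pm_scale scaleA) scaleQ \<kappa>"
  using fractions by (simp add: skew_field_of_fractions_def)

lemma hom_torus_map: "algebra_hom (pm_scale (*)) scaleQ torus_map"
  unfolding torus_map_def by (rule algebra_hom_comp[OF algebra_hom_tens_right hom_\<kappa>])

lemma hom_base_map: "algebra_hom scaleA scaleQ base_map"
  unfolding base_map_def by (rule algebra_hom_comp[OF algebra_hom_tens_left hom_\<kappa>])

lemma fraction: "\<exists>a b. \<kappa> b \<noteq> 0 \<and> z = \<kappa> a * inverse (\<kappa> b)"
  using fractions unfolding skew_field_of_fractions_def
  by (metis algebra_hom_simps(3) injD)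

lemma base_map_nonzero: "a \<noteq> 0 \<Longrightarrow> base_map a \<noteq> 0"
proof
  assume a: "a \<noteq> 0" and "base_map a = 0"
  then have "\<kappa> (tens scaleA a 1) = \<kappa> 0"
    by (simp add: base_map_def algebra_hom_simps[OF hom_\<kappa>])
  then have "tens scaleA a (1 :: 'y Uq_zero) = 0"
    using fractions by (auto simp: skew_field_of_fractions_def dest: injD)
  \<comment> \<open>The coefficient at exponent 0 recovers \<open>a\<close>.\<close>
  then have "Poly_Mapping.lookup (tens scaleA a (1 :: 'y Uq_zero)) 0 = 0" by simp
  with a show False by (simp add: lookup_one)
qed

text \<open>Centrality in the tensor product passes to fractions, since commuting with
  \<open>b\<close> entails commuting with its inverse.\<close>

lemma torus_map_central: "torus_map u * z = z * torus_map u"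
proof -
  have c: "torus_map u * \<kappa> p = \<kappa> p * torus_map u" for p
    using tens_one_central[of u p] by (simp add: torus_map_def flip: algebra_hom_simps(5)[OF hom_\<kappa>])
  obtain a b where z: "z = \<kappa> a * inverse (\<kappa> b)" using fraction by blast
  show ?thesis
    unfolding z using c[of a] commutes_inverse[OF c[of b]] by (metis mult.assoc)
qed

text \<open>Each monomial with coefficient \<open>a\<close> and exponent \<open>m\<close> is a
  product of a pure tensor from the generated algebra and a torus element.\<close>

lemma generated_induct [case_names torus gen one scale add mult]:
  assumes torus: "\<And>\<mu>. P (torus_map (torus \<mu>))" and gen: "\<And>j. P (base_map (f j))" and one: "P 1"
    and scale: "\<And>c z. P z \<Longrightarrow> P (scaleQ c z)"
    and add: "\<And>z w. P z \<Longrightarrow> P w \<Longrightarrow> P (z + w)" and mult: "\<And>z w. P z \<Longrightarrow> P w \<Longrightarrow> P (z * w)"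
  shows "P (\<kappa> p)"
proof (induction p rule: pm_induct)
  case (single m a)
  have "P (base_map a)"
    by (rule free_eval_induct[OF f_generate, where P = "\<lambda>a. P (base_map a)"])
      (simp_all add: algebra_hom_simps[OF hom_base_map] one scale add mult gen)
  moreover have "Poly_Mapping.single m a = tens scaleA a 1 * tens scaleA 1 (torus m)"
    unfolding tens_mult by (simp add: torus_def tens_single)
  then have "\<kappa> (Poly_Mapping.single m a) = base_map a * torus_map (torus m)"
    by (simp add: base_map_def torus_map_def algebra_hom_simps[OF hom_\<kappa>])
  ultimately show ?case by (simp add: mult torus)
qed (simp add: algebra_hom_simps[OF hom_\<kappa>] add)

text \<open>Homomorphisms of skew fields respect inverses, so agreement on generators spreads to all
  fractions.\<close>

lemma automorphism_unique:
  assumes h: "algebra_hom scaleQ scaleQ h" and h': "algebra_hom scaleQ scaleQ h'"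
    and "\<And>\<mu>. h (torus_map (torus \<mu>)) = h' (torus_map (torus \<mu>))"
    and "\<And>j. h (base_map (f j)) = h' (base_map (f j))"
  shows "h = h'"
proof
  fix z
  have \<kappa>: "h (\<kappa> p) = h' (\<kappa> p)" for p
    by (rule generated_induct) (simp_all add: assms algebra_hom_simps[OF h] algebra_hom_simps[OF h'])
  obtain a b where z: "z = \<kappa> a * inverse (\<kappa> b)" using fraction by blast
  show "h z = h' z"
    by (simp add: z \<kappa> algebra_hom_simps(5)[OF h] algebra_hom_simps(5)[OF h']
        algebra_hom_inverse[OF h] algebra_hom_inverse[OF h'])
qed

text \<open>For existence, each generator is \<open>twisted\<close>-related to its prescribed image;
  hence \<open>twisted\<close> is defined on the image of \<open>\<kappa>\<close> and extends to its
  fractions.\<close>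

lemma automorphism_ex1:
  assumes "generic_param (qi ds i)" and fi: "f i \<noteq> 0"
    and A: "\<And>j. j \<noteq> i \<Longrightarrow> A i j \<le> 0" and serre: "\<And>j. j \<noteq> i \<Longrightarrow> serre A ds scaleA f i j = 0"
  shows "\<exists>!\<gamma>. algebra_automorphism scaleQ \<gamma> \<and>
    (\<forall>\<mu>. \<gamma> (torus_map (torus \<mu>)) = torus_map (torus \<mu>)) \<and>
    (\<forall>j. \<gamma> (base_map (f j)) =
      (if i \<noteq> j then
        (\<Sum>k=0..nat (- A i j).
          torus_map (qi_wt_shift ds i (int k + A i j) lam (int k) * qbinom_wt ds i lam k)
          * base_map (ad_pow A ds scaleA f i j k) * base_map (f i) powi (- int k))
       else base_map (f i)))" (is "\<exists>!\<gamma>. ?Q \<gamma>")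
proof -
  define x where "x j = base_map (f j)" for j
  define P where "P m = torus_map (qi_wt ds i lam m)" for m
  interpret generic_param "qi ds i" by fact
  interpret Q: algebra_over scaleQ using hom_\<kappa> by (simp add: algebra_hom_def)
  interpret twist "qi ds i" scaleQ "x i" P
  proof
    show "x i \<noteq> 0" by (simp add: x_def base_map_nonzero fi)
    show "P m * z = z * P m" for m z unfolding P_def by (rule torus_map_central)
    show "P 0 = 1" "P (m + n) = P m * P n" for m n
      by (simp_all add: P_def qi_wt_0 qi_wt_add algebra_hom_simps[OF hom_torus_map])
  qed
  \<comment> \<open>The twist puts \<open>P (A i j + 2 * int r)\<close> in front of the r-th
    eigenvector; interpolation turns this sum into the prescribed formula.\<close>
  have img: "twisted (x j) (\<Sum>k=0..nat (- A i j).
        torus_map (qi_wt_shift ds i (int k + A i j) lam (int k) * qbinom_wt ds i lam k)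
        * base_map (ad_pow A ds scaleA f i j k) * x i powi (- int k))" if "j \<noteq> i" for j
  proof -
    define E where "E k = ad_pow A ds scaleQ x i j k * x i powi (- int k)" for k
    have le: "A i j \<le> 0" using A that by blast
    have "serre A ds scaleQ x i j = 0"
      using algebra_hom_serre[OF hom_base_map, of A ds f i j] serre[OF that]
      by (simp add: x_def[abs_def] algebra_hom_simps[OF hom_base_map])
    then obtain y where y: "\<And>r. r \<le> nat (- A i j) \<Longrightarrow> y r \<in> eigen (A i j + 2 * int r)"
      and E: "\<And>k. E k = (\<Sum>r\<le>nat (- A i j). scaleQ
        (\<Prod>\<nu><k. qi ds i powi (A i j + 2 * int r) - qi ds i powi (A i j + 2 * int \<nu>)) (y r))"
      and xj: "x j = (\<Sum>r\<le>nat (- A i j). y r)"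
      unfolding E_def using serre_eigenvectors[where A = A and x = x and i = i, OF conjugation_axioms _ le] by blast
    have "twisted (x j) (\<Sum>r\<le>nat (- A i j). P (A i j + 2 * int r) * y r)"
      unfolding xj by (intro twisted_sum twisted.eigen y) simp
    also have "(\<Sum>r\<le>nat (- A i j). P (A i j + 2 * int r) * y r)
      = (\<Sum>k\<le>nat (- A i j). torus_map (weight_coeff (pm_scale (*)) (qi ds i) (qi_wt ds i lam) (A i j) k) * E k)"
      unfolding P_def
      by (rule weighted_sum_eigenvectors[OF generic_param_axioms hom_torus_map qi_wt_0 qi_wt_add E, symmetric])
    finally show ?thesis
      unfolding weight_coeff_qi_wt E_def
      by (simp add: atMost_atLeast0 mult.assoc x_def[abs_def] algebra_hom_ad_pow[OF hom_base_map])
  qed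
  \<comment> \<open>Central elements have weight 0, and \<open>P 0 = 1\<close>.\<close>
  have torus: "twisted (torus_map u) (torus_map u)" for u
    by (intro twisted_commuting) (simp add: torus_map_central)
  have total: "\<exists>z. twisted (\<kappa> p) z" for p
  proof (rule generated_induct)
    show "\<exists>w. twisted (scaleQ c z) w" if "\<exists>w. twisted z w" for c z
    proof -
      have "twisted (scaleQ c 1) (scaleQ c 1)"
        by (intro twisted_commuting) (simp add: Q.scale_mult_left Q.scale_mult_right)
      then show ?thesis
        using that twisted_mult[of "scaleQ c 1" _ z] by (auto simp: Q.scale_mult_left)
    qed
    show "\<exists>w. twisted (base_map (f j)) w" for j
      using img[of j] twisted_commuting[of "x i"] by (cases "j = i") (auto simp: x_def)
    show "\<exists>w. twisted 1 w" using twisted_commuting[of 1] by auto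
  qed (blast intro: torus twisted.add twisted_mult)+
  have "\<exists>a b a' b'. twisted a a' \<and> twisted b b' \<and> b \<noteq> 0 \<and> z = a * inverse b" for z
    using fraction[of z] total by blast
  then obtain h where h: "algebra_automorphism scaleQ h" "\<And>z z'. twisted z z' \<Longrightarrow> h z = z'"
    using twisted_extends by blast
  \<comment> \<open>The case \<open>j = i\<close> holds because \<open>x i\<close> commutes with
    itself.\<close>
  have "?Q h"
    using h(1) h(2)[OF torus] h(2)[OF img] h(2)[OF twisted_commuting, of "x i"]
    by (auto simp: x_def)
  moreover have "\<gamma> = \<gamma>'" if "?Q \<gamma>" "?Q \<gamma>'" for \<gamma> \<gamma>'
    using that by (intro automorphism_unique) (simp_all add: algebra_automorphism_def)
  ultimately show ?thesis by blast
qed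

end

section \<open>Transfer from U_q^- to the two skew fields of fractions\<close>

theorem mainTheorem5:
  fixes A :: "'i::finite \<Rightarrow> 'i \<Rightarrow> int"
    and ds :: "'i \<Rightarrow> rat"
    and pair :: "'y::ab_group_add \<Rightarrow> 'x::ab_group_add \<Rightarrow> int"
    and coroot :: "'i \<Rightarrow> 'y"
    and sroot :: "'i \<Rightarrow> 'x"
    and scaleU :: "qfield \<Rightarrow> 'u::ring_1 \<Rightarrow> 'u"
    and F :: "'i \<Rightarrow> 'u"
    and scaleA :: "qfield \<Rightarrow> 'a::ring_1 \<Rightarrow> 'a"
    and \<pi> :: "'u \<Rightarrow> 'a"
    and f :: "'i \<Rightarrow> 'a"
    and scaleQ0 :: "qfield \<Rightarrow> 'p::division_ring \<Rightarrow> 'p"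
    and \<kappa>0 :: "'a \<Rightarrow> 'p"
    and scaleQ :: "qfield \<Rightarrow> 'q::division_ring \<Rightarrow> 'q"
    and \<kappa> :: "('y \<Rightarrow>\<^sub>0 'a) \<Rightarrow> 'q"
    and i :: 'i
  assumes "gen_cartan_matrix A" and "symmetrized_by A ds"
    and "root_datum A pair coroot sroot"
    and "is_Uq_minus A ds scaleU F"
    and "quotient_algebra scaleU scaleA \<pi>"
    and "tempered_domain scaleA"
    and "\<And>j. f j = \<pi> (F j)"
    and "skew_field_of_fractions scaleA scaleQ0 \<kappa>0"
    and "skew_field_of_fractions (pm_scale scaleA) scaleQ \<kappa>"
    and "f i \<noteq> 0"
  shows "(\<forall>(n::int) j. j \<noteq> i \<longrightarrow>
           \<kappa>0 (f i) powi n * \<kappa>0 (f j) * \<kappa>0 (f i) powi (- n) =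
             (\<Sum>k=0..nat (- A i j).
                scaleQ0 (qi ds i powi ((int k + A i j) * (n - int k)) * qbinom (qi ds i) n k)
                  (\<kappa>0 (ad_pow A ds scaleA f i j k) * \<kappa>0 (f i) powi (- int k)))) \<and>
         (\<forall>lam::'y. \<exists>!\<gamma>.
           algebra_automorphism scaleQ \<gamma> \<and>
           (\<forall>\<mu>. \<gamma> (\<kappa> (tens scaleA 1 (torus \<mu>))) = \<kappa> (tens scaleA 1 (torus \<mu>))) \<and>
           (\<forall>j. \<gamma> (\<kappa> (tens scaleA (f j) 1)) =
              (if i \<noteq> j then
                 (\<Sum>k=0..nat (- A i j).
                    \<kappa> (tens scaleA 1 (qi_wt_shift ds i (int k + A i j) lam (int k) * qbinom_wt ds i lam k))
                    * \<kappa> (tens scaleA (ad_pow A ds scaleA f i j k) 1)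
                    * \<kappa> (tens scaleA (f i) 1) powi (- int k))
               else \<kappa> (tens scaleA (f i) 1))))"
proof (intro conjI allI impI)
  have over: "algebra_over scaleA" and hom\<pi>: "algebra_hom scaleU scaleA \<pi>"
    and hom\<kappa>0: "algebra_hom scaleA scaleQ0 \<kappa>0" and inj\<kappa>0: "inj \<kappa>0"
    using assms(5,6,8) by (auto simp: tempered_domain_def quotient_algebra_def skew_field_of_fractions_def)
  have f_eq: "f = (\<lambda>j. \<pi> (F j))" using assms(7) by auto
  have generic: "generic_param (qi ds i)"
    using assms(2) by (intro qi_generic) (simp add: symmetrized_by_def)
  have A: "A i j \<le> 0" if "j \<noteq> i" for j
    using assms(1) that by (simp add: gen_cartan_matrix_def)
  \<comment> \<open>The Serre relations descend along \<open>\<pi>\<close>.\<close>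
  have serre: "serre A ds scaleA f i j = 0" if "j \<noteq> i" for j
    using algebra_hom_serre[OF hom\<pi>, of A ds F i j] serre_presented[OF assms(4), of i j] that
    by (simp add: f_eq algebra_hom_simps[OF hom\<pi>])
  {
    fix n :: int and j
    assume j: "j \<noteq> i"
    have "\<kappa>0 (f i) \<noteq> 0"
      using assms(10) inj\<kappa>0 by (metis algebra_hom_simps(3)[OF hom\<kappa>0] injD)
    then have "conjugation (qi ds i) scaleQ0 (\<kappa>0 (f i))"
      using generic hom\<kappa>0
      by (simp add: conjugation_def conjugation_axioms_def algebra_hom_def)
    moreover have "serre A ds scaleQ0 (\<lambda>j. \<kappa>0 (f j)) i j = 0"
      using algebra_hom_serre[OF hom\<kappa>0, of A ds f i j] serre[OF j]
      by (simp add: algebra_hom_simps[OF hom\<kappa>0])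
    ultimately show "\<kappa>0 (f i) powi n * \<kappa>0 (f j) * \<kappa>0 (f i) powi (- n) =
        (\<Sum>k=0..nat (- A i j).
          scaleQ0 (qi ds i powi ((int k + A i j) * (n - int k)) * qbinom (qi ds i) n k)
            (\<kappa>0 (ad_pow A ds scaleA f i j k) * \<kappa>0 (f i) powi (- int k)))"
      using powi_conj_serre[of ds i scaleQ0 "\<lambda>j. \<kappa>0 (f j)" A j n] A[OF j]
      by (simp add: algebra_hom_ad_pow[OF hom\<kappa>0])
  next
    fix lam :: 'y
    \<comment> \<open>Every element lifts along \<open>\<pi>\<close> to a polynomial in the
      generators \<open>F j\<close>.\<close>
    have "surj (free_eval scaleA f)"
    proof (rule surjI)
      fix a
      have "surj (free_eval scaleU F)" "surj \<pi>"
        using assms(4,5) by (auto simp: is_Uq_minus_def presented_by_def quotient_algebra_def)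
      then have "\<exists>p. free_eval scaleA f p = a"
        unfolding f_eq free_eval_hom[OF hom\<pi>, symmetric] by (metis surjD)
      then show "free_eval scaleA f (SOME p. free_eval scaleA f p = a) = a" by (rule someI_ex)
    qed
    then interpret torus_extension scaleA scaleQ \<kappa> f
      using over assms(9) by (simp add: torus_extension_def torus_extension_axioms_def)
    show "\<exists>!\<gamma>.
       algebra_automorphism scaleQ \<gamma> \<and>
       (\<forall>\<mu>. \<gamma> (\<kappa> (tens scaleA 1 (torus \<mu>))) = \<kappa> (tens scaleA 1 (torus \<mu>))) \<and>
       (\<forall>j. \<gamma> (\<kappa> (tens scaleA (f j) 1)) =
          (if i \<noteq> j then
             (\<Sum>k=0..nat (- A i j).
                \<kappa> (tens scaleA 1 (qi_wt_shift ds i (int k + A i j) lam (int k) * qbinom_wt ds i lam k))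
                * \<kappa> (tens scaleA (ad_pow A ds scaleA f i j k) 1)
                * \<kappa> (tens scaleA (f i) 1) powi (- int k))
           else \<kappa> (tens scaleA (f i) 1)))"
      by (rule automorphism_ex1[OF generic assms(10) A serre, unfolded torus_map_def base_map_def])
  }
qed

end
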